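(* Let $\mathcal{T}$ be a triangulated category, let $X\xrightarrow{u}Y\xrightarrow{v}Z\xrightarrow{w}\Sigma X$ be an exact triangle, and let $h\colon Z\to\Sigma X$ be a map such that $(u,v,h)$ is a map of triangles from $X\xrightarrow{u}Y\xrightarrow{v}Z\xrightarrow{w}\Sigma X$ to its rotation $Y\xrightarrow{v}Z\xrightarrow{w}\Sigma X\xrightarrow{-\Sigma u}\Sigma Y$. Then the following are equivalent: (1) The map $(u,v,h)$ is good. (2) The map $(u,v,h)$ is Verdier good. (3) The Toda bracket $\langle-\Sigma u,h,v\rangle\subseteq\mathcal{T}(\Sigma Y,\Sigma Y)$ contains zero. (4) The map $h$ is a lightning flash, i.e. $h=w\theta w$ for some $\theta\colon\Sigma X\to Z$. When $h=w$, these conditions are also equivalent to the given triangle $X\xrightarrow{u}Y\xrightarrow{v}Z\xrightarrow{w}\Sigma X$ being contractible.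
   Context: $\mathcal{T}$ is a triangulated category with self-equivalence $\Sigma$. "Exact triangle" or "triangle" means distinguished triangle. A map of triangles $(f,g,h)$ from $X\xrightarrow{u}Y\xrightarrow{v}Z\xrightarrow{w}\Sigma X$ to $X'\xrightarrow{u'}Y'\xrightarrow{v'}Z'\xrightarrow{w'}\Sigma X'$ consists of $f\colon X\to X'$, $g\colon Y\to Y'$, $h\colon Z\to Z'$ with $gu=u'f$, $hv=v'g$, $(\Sigma f)w=w'h$. It is nullhomotopic if there are maps $F\colon Y\to X'$, $G\colon Z\to Y'$, $H\colon\Sigma X\to Z'$ with $f=Fu+\Sigma^{-1}(w'H)$, $g=Gv+u'F$, $h=Hw+v'G$. A triangle is contractible if its identity map $(1_X,1_Y,1_Z)$ is nullhomotopic. The mapping cone of $(f,g,h)$ is the sequence $X'\oplus Y\to Y'\oplus Z\to Z'\oplus\Sigma X\to\Sigma X'\oplus\Sigma Y$ with successive maps $\begin{bmatrix}u'&g\\0&-v\end{bmatrix},\begin{bmatrix}v'&h\\0&-w\end{bmatrix},\begin{bmatrix}w'&\Sigma f\\0&-\Sigma u\end{bmatrix}$ (acting on column vectors). $(f,g,h)$ is good if its mapping cone is an exact triangle. Octahedra: given composable maps $P\xrightarrow{a}Q\xrightarrow{b}R$ and exact triangles $P\xrightarrow{a}Q\xrightarrow{a'}C_a\xrightarrow{a''}\Sigma P$, $Q\xrightarrow{b}R\xrightarrow{b'}C_b\xrightarrow{b''}\Sigma Q$, $P\xrightarrow{ba}R\xrightarrow{c'}C\xrightarrow{c''}\Sigma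 P$, an octahedron for the composite $ba$ consists of maps $\alpha\colon C_a\to C$, $\beta\colon C\to C_b$, $\gamma\colon C_b\to\Sigma C_a$ such that $C_a\xrightarrow{\alpha}C\xrightarrow{\beta}C_b\xrightarrow{\gamma}\Sigma C_a$ is exact and $\alpha a'=c'b$, $c''\alpha=a''$, $\beta c'=b'$, $\gamma=(\Sigma a')b''$, $b''\beta=(\Sigma a)c''$. Verdier good: choose exact triangles $X\xrightarrow{f}X'\xrightarrow{f'}X''\xrightarrow{f''}\Sigma X$, $Y\xrightarrow{g}Y'\xrightarrow{g'}Y''\xrightarrow{g''}\Sigma Y$ and $X\xrightarrow{gu=u'f}Y'\xrightarrow{\tilde v}A\xrightarrow{\tilde w}\Sigma X$. The map $(f,g,h)$ is Verdier good if there exist an octahedron $(\alpha_1\colon Z\to A,\ \beta_1\colon A\to Y'',\ \gamma_1)$ for the composite $X\xrightarrow{u}Y\xrightarrow{g}Y'$ and an octahedron $(\alpha_2\colon X''\to A,\ \beta_2\colon A\to Z',\ \gamma_2)$ for the composite $X\xrightarrow{f}X'\xrightarrow{u'}Y'$ (both using the given and chosen triangles, in particular the same triangle on $gu=u'f$) such that $h=\beta_2\alpha_1$. This does not depend on the chosen triangles. Toda bracket: for composable maps $A_0\xrightarrow{a_1}A_1\xrightarrow{a_2}A_2\xrightarrow{a_3}A_3$, choose an exact triangle $A_0\xrightarrow{a_1}A_1\xrightarrow{p}C\xrightarrow{q}\Sigma A_0$. Then $\langle a_3,a_2,a_1\rangle\subseteq\mathcal{T}(\Sigma A_0,A_3)$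 is the set of maps $\psi\colon\Sigma A_0\to A_3$ for which there exists $\varphi\colon C\to A_2$ with $\varphi p=a_2$ and $a_3\varphi=\psi q$. *)

theory Defs
  imports "HOL-Algebra.Group"
begin

section \<open>Additive categories\<close>

record ('o, 'm) category =
  Ob :: "'o set"
  Arr :: "'m set"
  Dom :: "'m \<Rightarrow> 'o"
  Cod :: "'m \<Rightarrow> 'o"
  Ident :: "'o \<Rightarrow> 'm"
  Comp :: "'m \<Rightarrow> 'm \<Rightarrow> 'm" (infixr "\<cdot>\<index>" 70)

text \<open>Composition is written in the usual order: \<open>g \<cdot> f\<close> is \<open>g\<close> after \<open>f\<close>. Outside the carriers
  the operations are unspecified.\<close>

definition Hom :: "('o, 'm, 'z) category_scheme \<Rightarrow> 'o \<Rightarrow> 'o \<Rightarrow> 'm set" where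
  "Hom T X Y = {f \<in> Arr T. Dom T f = X \<and> Cod T f = Y}"

locale category =
  fixes T :: "('o, 'm, 'z) category_scheme" (structure)
  assumes Dom_in_Ob: "f \<in> Arr T \<Longrightarrow> Dom T f \<in> Ob T"
    and Cod_in_Ob: "f \<in> Arr T \<Longrightarrow> Cod T f \<in> Ob T"
    and Ident_in_Hom: "X \<in> Ob T \<Longrightarrow> Ident T X \<in> Hom T X X"
    and Comp_in_Hom: "\<lbrakk>f \<in> Hom T X Y; g \<in> Hom T Y Z\<rbrakk> \<Longrightarrow> g \<cdot> f \<in> Hom T X Z"
    and Comp_Ident: "f \<in> Hom T X Y \<Longrightarrow> f \<cdot> Ident T X = f"
    and Ident_Comp: "f \<in> Hom T X Y \<Longrightarrow> Ident T Y \<cdot> f = f"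
    and Comp_assoc: "\<lbrakk>f \<in> Hom T X Y; g \<in> Hom T Y Z; h \<in> Hom T Z W\<rbrakk>
      \<Longrightarrow> (h \<cdot> g) \<cdot> f = h \<cdot> (g \<cdot> f)"

definition iso_arr :: "('o, 'm, 'z) category_scheme \<Rightarrow> 'm \<Rightarrow> bool" where
  "iso_arr T f \<longleftrightarrow> f \<in> Arr T \<and> (\<exists>g \<in> Hom T (Cod T f) (Dom T f).
     g \<cdot>\<^bsub>T\<^esub> f = Ident T (Dom T f) \<and> f \<cdot>\<^bsub>T\<^esub> g = Ident T (Cod T f))"

definition zero_object :: "('o, 'm, 'z) category_scheme \<Rightarrow> 'o \<Rightarrow> bool" where
  "zero_object T N \<longleftrightarrow> N \<in> Ob T \<and>
     (\<forall>X \<in> Ob T. (\<exists>!f. f \<in> Hom T N X) \<and> (\<exists>!f. f \<in> Hom T X N))"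

record ('o, 'm) additive_category = "('o, 'm) category" +
  Add :: "'m \<Rightarrow> 'm \<Rightarrow> 'm" (infixl "\<oplus>\<index>" 65)
  Zero :: "'o \<Rightarrow> 'o \<Rightarrow> 'm"

definition Hom_group :: "('o, 'm, 'z) additive_category_scheme \<Rightarrow> 'o \<Rightarrow> 'o \<Rightarrow> 'm monoid" where
  "Hom_group T X Y = \<lparr>carrier = Hom T X Y, mult = Add T, one = Zero T X Y\<rparr>"

definition neg :: "('o, 'm, 'z) additive_category_scheme \<Rightarrow> 'm \<Rightarrow> 'm" ("\<ominus>\<index> _" [81] 80) where
  "\<ominus>\<^bsub>T\<^esub> f = inv\<^bsub>Hom_group T (Dom T f) (Cod T f)\<^esub> f"

definition is_biproduct ::
  "('o, 'm, 'z) additive_category_scheme \<Rightarrow> 'o \<Rightarrow> 'o \<Rightarrow> 'm \<times> 'm \<times> 'm \<times> 'm \<Rightarrow> bool" where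
  "is_biproduct T X Y = (\<lambda>(i1, i2, p1, p2). \<exists>P \<in> Ob T.
     i1 \<in> Hom T X P \<and> i2 \<in> Hom T Y P \<and> p1 \<in> Hom T P X \<and> p2 \<in> Hom T P Y \<and>
     p1 \<cdot>\<^bsub>T\<^esub> i1 = Ident T X \<and> p2 \<cdot>\<^bsub>T\<^esub> i2 = Ident T Y \<and>
     p1 \<cdot>\<^bsub>T\<^esub> i2 = Zero T Y X \<and> p2 \<cdot>\<^bsub>T\<^esub> i1 = Zero T X Y \<and>
     (i1 \<cdot>\<^bsub>T\<^esub> p1) \<oplus>\<^bsub>T\<^esub> (i2 \<cdot>\<^bsub>T\<^esub> p2) = Ident T P)"

locale additive_category = category T
  for T :: "('o, 'm, 'z) additive_category_scheme" (structure) +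
  assumes Hom_comm_group: "\<lbrakk>X \<in> Ob T; Y \<in> Ob T\<rbrakk> \<Longrightarrow> comm_group (Hom_group T X Y)"
    and Comp_Add: "\<lbrakk>f \<in> Hom T X Y; f' \<in> Hom T X Y; g \<in> Hom T Y Z\<rbrakk>
      \<Longrightarrow> g \<cdot> (f \<oplus> f') = (g \<cdot> f) \<oplus> (g \<cdot> f')"
    and Add_Comp: "\<lbrakk>f \<in> Hom T X Y; g \<in> Hom T Y Z; g' \<in> Hom T Y Z\<rbrakk>
      \<Longrightarrow> (g \<oplus> g') \<cdot> f = (g \<cdot> f) \<oplus> (g' \<cdot> f)"
    and zero_object_exists: "\<exists>N. zero_object T N"
    and biproduct_exists: "\<lbrakk>X \<in> Ob T; Y \<in> Ob T\<rbrakk> \<Longrightarrow> \<exists>B. is_biproduct T X Y B"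

text \<open>A chosen direct sum of \<open>X\<close> and \<open>Y\<close>, given by its two inclusions and two projections.\<close>

definition biprod ::
  "('o, 'm, 'z) additive_category_scheme \<Rightarrow> 'o \<Rightarrow> 'o \<Rightarrow> 'm \<times> 'm \<times> 'm \<times> 'm" where
  "biprod T X Y = (SOME B. is_biproduct T X Y B)"

text \<open>The map between direct sums with matrix \<open>[[a, b], [c, d]]\<close> acting on column vectors, where
  \<open>p1\<close>, \<open>p2\<close> are the projections of the source and \<open>j1\<close>, \<open>j2\<close> the inclusions of the target.\<close>

definition matrix_map ::
  "('o, 'm, 'z) additive_category_scheme \<Rightarrow> 'm \<times> 'm \<Rightarrow> 'm \<times> 'm \<Rightarrow> ('m \<times> 'm) \<times> ('m \<times> 'm) \<Rightarrow> 'm" where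
  "matrix_map T = (\<lambda>(p1, p2) (j1, j2) ((a, b), (c, d)).
     (j1 \<cdot>\<^bsub>T\<^esub> ((a \<cdot>\<^bsub>T\<^esub> p1) \<oplus>\<^bsub>T\<^esub> (b \<cdot>\<^bsub>T\<^esub> p2))) \<oplus>\<^bsub>T\<^esub>
     (j2 \<cdot>\<^bsub>T\<^esub> ((c \<cdot>\<^bsub>T\<^esub> p1) \<oplus>\<^bsub>T\<^esub> (d \<cdot>\<^bsub>T\<^esub> p2))))"


section \<open>Triangulated categories\<close>

text \<open>A triangle \<open>X \<rightarrow> Y \<rightarrow> Z \<rightarrow> \<Sigma>X\<close> is given by its three maps \<open>(u, v, w)\<close>; the objects are recovered
  as the domains of these maps. \<open>Susp\<close> and \<open>susp\<close> are the action of \<open>\<Sigma>\<close> on objects and on maps.\<close>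

record ('o, 'm) triangulated_category = "('o, 'm) additive_category" +
  Susp :: "'o \<Rightarrow> 'o"
  susp :: "'m \<Rightarrow> 'm"
  Exact :: "('m \<times> 'm \<times> 'm) set"

definition candidate_triangle ::
  "('o, 'm, 'z) triangulated_category_scheme \<Rightarrow> 'm \<times> 'm \<times> 'm \<Rightarrow> bool" where
  "candidate_triangle T = (\<lambda>(u, v, w). \<exists>X Y Z.
     u \<in> Hom T X Y \<and> v \<in> Hom T Y Z \<and> w \<in> Hom T Z (Susp T X))"

definition triangle_map :: "('o, 'm, 'z) triangulated_category_scheme \<Rightarrow>
    'm \<times> 'm \<times> 'm \<Rightarrow> 'm \<times> 'm \<times> 'm \<Rightarrow> 'm \<times> 'm \<times> 'm \<Rightarrow> bool" where
  "triangle_map T = (\<lambda>(u, v, w) (u', v', w') (f, g, h).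
     f \<in> Hom T (Dom T u) (Dom T u') \<and> g \<in> Hom T (Dom T v) (Dom T v') \<and>
     h \<in> Hom T (Dom T w) (Dom T w') \<and>
     g \<cdot>\<^bsub>T\<^esub> u = u' \<cdot>\<^bsub>T\<^esub> f \<and> h \<cdot>\<^bsub>T\<^esub> v = v' \<cdot>\<^bsub>T\<^esub> g \<and> susp T f \<cdot>\<^bsub>T\<^esub> w = w' \<cdot>\<^bsub>T\<^esub> h)"

definition octahedron :: "('o, 'm, 'z) triangulated_category_scheme \<Rightarrow>
    'm \<times> 'm \<times> 'm \<Rightarrow> 'm \<times> 'm \<times> 'm \<Rightarrow> 'm \<times> 'm \<times> 'm \<Rightarrow> 'm \<times> 'm \<times> 'm \<Rightarrow> bool" where
  "octahedron T = (\<lambda>(a, a', a'') (b, b', b'') (c, c', c'') (\<alpha>, \<beta>, \<gamma>).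
     \<alpha> \<in> Hom T (Cod T a') (Cod T c') \<and> \<beta> \<in> Hom T (Cod T c') (Cod T b') \<and>
     \<gamma> \<in> Hom T (Cod T b') (Susp T (Cod T a')) \<and> (\<alpha>, \<beta>, \<gamma>) \<in> Exact T \<and>
     \<alpha> \<cdot>\<^bsub>T\<^esub> a' = c' \<cdot>\<^bsub>T\<^esub> b \<and> c'' \<cdot>\<^bsub>T\<^esub> \<alpha> = a'' \<and> \<beta> \<cdot>\<^bsub>T\<^esub> c' = b' \<and>
     \<gamma> = susp T a' \<cdot>\<^bsub>T\<^esub> b'' \<and> b'' \<cdot>\<^bsub>T\<^esub> \<beta> = susp T a \<cdot>\<^bsub>T\<^esub> c'')"

text \<open>A self-equivalence is rendered as a fully faithful and essentially surjective functor;
  it is not required to be bijective on objects.\<close>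

locale triangulated_category = additive_category T
  for T :: "('o, 'm, 'z) triangulated_category_scheme" (structure) +
  assumes Susp_in_Ob: "X \<in> Ob T \<Longrightarrow> Susp T X \<in> Ob T"
    and susp_Ident: "X \<in> Ob T \<Longrightarrow> susp T (Ident T X) = Ident T (Susp T X)"
    and susp_Comp: "\<lbrakk>f \<in> Hom T X Y; g \<in> Hom T Y Z\<rbrakk> \<Longrightarrow> susp T (g \<cdot> f) = susp T g \<cdot> susp T f"
    and susp_Add: "\<lbrakk>f \<in> Hom T X Y; g \<in> Hom T X Y\<rbrakk> \<Longrightarrow> susp T (f \<oplus> g) = susp T f \<oplus> susp T g"
    and susp_bij: "\<lbrakk>X \<in> Ob T; Y \<in> Ob T\<rbrakk>
      \<Longrightarrow> bij_betw (susp T) (Hom T X Y) (Hom T (Susp T X) (Susp T Y))"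
    and Susp_ess_surj: "Y \<in> Ob T \<Longrightarrow> \<exists>X \<in> Ob T. \<exists>f \<in> Hom T (Susp T X) Y. iso_arr T f"
    and Exact_candidate: "t \<in> Exact T \<Longrightarrow> candidate_triangle T t"
    and Exact_iso: "\<lbrakk>t \<in> Exact T; candidate_triangle T t'; triangle_map T t t' (f, g, h);
      iso_arr T f; iso_arr T g; iso_arr T h\<rbrakk> \<Longrightarrow> t' \<in> Exact T"
    and Exact_Ident: "\<lbrakk>X \<in> Ob T; zero_object T N\<rbrakk>
      \<Longrightarrow> (Ident T X, Zero T X N, Zero T N (Susp T X)) \<in> Exact T"
    and Exact_exists: "u \<in> Arr T \<Longrightarrow> \<exists>v w. (u, v, w) \<in> Exact T"
    and Exact_rotate: "candidate_triangle T (u, v, w)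
      \<Longrightarrow> (u, v, w) \<in> Exact T \<longleftrightarrow> (v, w, \<ominus> susp T u) \<in> Exact T"
    and Exact_fill: "\<lbrakk>(u, v, w) \<in> Exact T; (u', v', w') \<in> Exact T;
      f \<in> Hom T (Dom T u) (Dom T u'); g \<in> Hom T (Cod T u) (Cod T u'); g \<cdot> u = u' \<cdot> f\<rbrakk>
      \<Longrightarrow> \<exists>h. triangle_map T (u, v, w) (u', v', w') (f, g, h)"
    and octahedral_axiom: "\<lbrakk>a \<in> Hom T P Q; b \<in> Hom T Q R; (a, a', a'') \<in> Exact T;
      (b, b', b'') \<in> Exact T; (b \<cdot> a, c', c'') \<in> Exact T\<rbrakk>
      \<Longrightarrow> \<exists>\<alpha> \<beta> \<gamma>. octahedron T (a, a', a'') (b, b', b'') (b \<cdot> a, c', c'') (\<alpha>, \<beta>, \<gamma>)"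

text \<open>The action of \<open>\<Sigma>\<inverse>\<close> on maps \<open>\<Sigma>X \<rightarrow> \<Sigma>Y\<close>: the inverse of the bijection
  \<open>Hom T X Y \<rightarrow> Hom T (Susp T X) (Susp T Y)\<close>.\<close>

definition desusp :: "('o, 'm, 'z) triangulated_category_scheme \<Rightarrow> 'o \<Rightarrow> 'o \<Rightarrow> 'm \<Rightarrow> 'm" where
  "desusp T X Y = the_inv_into (Hom T X Y) (susp T)"

definition nullhomotopic :: "('o, 'm, 'z) triangulated_category_scheme \<Rightarrow>
    'm \<times> 'm \<times> 'm \<Rightarrow> 'm \<times> 'm \<times> 'm \<Rightarrow> 'm \<times> 'm \<times> 'm \<Rightarrow> bool" where
  "nullhomotopic T = (\<lambda>(u, v, w) (u', v', w') (f, g, h).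
     \<exists>F \<in> Hom T (Dom T v) (Dom T u'). \<exists>G \<in> Hom T (Dom T w) (Dom T v').
     \<exists>H \<in> Hom T (Susp T (Dom T u)) (Dom T w').
       f = (F \<cdot>\<^bsub>T\<^esub> u) \<oplus>\<^bsub>T\<^esub> desusp T (Dom T u) (Dom T u') (w' \<cdot>\<^bsub>T\<^esub> H) \<and>
       g = (G \<cdot>\<^bsub>T\<^esub> v) \<oplus>\<^bsub>T\<^esub> (u' \<cdot>\<^bsub>T\<^esub> F) \<and>
       h = (H \<cdot>\<^bsub>T\<^esub> w) \<oplus>\<^bsub>T\<^esub> (v' \<cdot>\<^bsub>T\<^esub> G))"

definition contractible ::
  "('o, 'm, 'z) triangulated_category_scheme \<Rightarrow> 'm \<times> 'm \<times> 'm \<Rightarrow> bool" where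
  "contractible T = (\<lambda>(u, v, w). nullhomotopic T (u, v, w) (u, v, w)
     (Ident T (Dom T u), Ident T (Dom T v), Ident T (Dom T w)))"

text \<open>The last object of the cone is \<open>\<Sigma>X' \<oplus> \<Sigma>Y\<close>, identified with \<open>\<Sigma>(X' \<oplus> Y)\<close>: since \<open>\<Sigma>\<close> is
  additive, the latter is a direct sum via the suspended inclusions and projections.\<close>

definition mapping_cone :: "('o, 'm, 'z) triangulated_category_scheme \<Rightarrow>
    'm \<times> 'm \<times> 'm \<Rightarrow> 'm \<times> 'm \<times> 'm \<Rightarrow> 'm \<times> 'm \<times> 'm \<Rightarrow> 'm \<times> 'm \<times> 'm" where
  "mapping_cone T = (\<lambda>(u, v, w) (u', v', w') (f, g, h).
     let X = Dom T u; Y = Dom T v; Z = Dom T w;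
         X' = Dom T u'; Y' = Dom T v'; Z' = Dom T w';
         (i1, i2, p1, p2) = biprod T X' Y;
         (j1, j2, q1, q2) = biprod T Y' Z;
         (k1, k2, r1, r2) = biprod T Z' (Susp T X)
     in (matrix_map T (p1, p2) (j1, j2) ((u', g), (Zero T X' Z, \<ominus>\<^bsub>T\<^esub> v)),
         matrix_map T (q1, q2) (k1, k2) ((v', h), (Zero T Y' (Susp T X), \<ominus>\<^bsub>T\<^esub> w)),
         matrix_map T (r1, r2) (susp T i1, susp T i2)
           ((w', susp T f), (Zero T Z' (Susp T Y), \<ominus>\<^bsub>T\<^esub> susp T u))))"

definition good :: "('o, 'm, 'z) triangulated_category_scheme \<Rightarrow>
    'm \<times> 'm \<times> 'm \<Rightarrow> 'm \<times> 'm \<times> 'm \<Rightarrow> 'm \<times> 'm \<times> 'm \<Rightarrow> bool" where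
  "good T t t' m \<longleftrightarrow> mapping_cone T t t' m \<in> Exact T"

text \<open>In the next two definitions the auxiliary exact triangles are existentially quantified;
  the notions do not depend on which ones are chosen.\<close>

definition Verdier_good :: "('o, 'm, 'z) triangulated_category_scheme \<Rightarrow>
    'm \<times> 'm \<times> 'm \<Rightarrow> 'm \<times> 'm \<times> 'm \<Rightarrow> 'm \<times> 'm \<times> 'm \<Rightarrow> bool" where
  "Verdier_good T = (\<lambda>(u, v, w) (u', v', w') (f, g, h).
     \<exists>f' f'' g' g'' v\<^sub>A w\<^sub>A.
       (f, f', f'') \<in> Exact T \<and> (g, g', g'') \<in> Exact T \<and> (g \<cdot>\<^bsub>T\<^esub> u, v\<^sub>A, w\<^sub>A) \<in> Exact T \<and>
       (\<exists>\<alpha>\<^sub>1 \<beta>\<^sub>1 \<gamma>\<^sub>1 \<alpha>\<^sub>2 \<beta>\<^sub>2 \<gamma>\<^sub>2.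
         octahedron T (u, v, w) (g, g', g'') (g \<cdot>\<^bsub>T\<^esub> u, v\<^sub>A, w\<^sub>A) (\<alpha>\<^sub>1, \<beta>\<^sub>1, \<gamma>\<^sub>1) \<and>
         octahedron T (f, f', f'') (u', v', w') (u' \<cdot>\<^bsub>T\<^esub> f, v\<^sub>A, w\<^sub>A) (\<alpha>\<^sub>2, \<beta>\<^sub>2, \<gamma>\<^sub>2) \<and>
         h = \<beta>\<^sub>2 \<cdot>\<^bsub>T\<^esub> \<alpha>\<^sub>1))"

definition Toda_bracket ::
  "('o, 'm, 'z) triangulated_category_scheme \<Rightarrow> 'm \<Rightarrow> 'm \<Rightarrow> 'm \<Rightarrow> 'm set" where
  "Toda_bracket T a\<^sub>3 a\<^sub>2 a\<^sub>1 = {\<psi> \<in> Hom T (Susp T (Dom T a\<^sub>1)) (Cod T a\<^sub>3).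
     \<exists>p q. (a\<^sub>1, p, q) \<in> Exact T \<and>
       (\<exists>\<phi> \<in> Hom T (Cod T p) (Cod T a\<^sub>2). \<phi> \<cdot>\<^bsub>T\<^esub> p = a\<^sub>2 \<and> a\<^sub>3 \<cdot>\<^bsub>T\<^esub> \<phi> = \<psi> \<cdot>\<^bsub>T\<^esub> q)}"

definition lightning_flash ::
  "('o, 'm, 'z) triangulated_category_scheme \<Rightarrow> 'm \<times> 'm \<times> 'm \<Rightarrow> 'm \<Rightarrow> bool" where
  "lightning_flash T = (\<lambda>(u, v, w) h.
     \<exists>\<theta> \<in> Hom T (Susp T (Dom T u)) (Dom T w). h = w \<cdot>\<^bsub>T\<^esub> \<theta> \<cdot>\<^bsub>T\<^esub> w)"

end

theory Submission
  imports Defs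
begin

text \<open>
  That \<open>(u, v, h)\<close> is a map of triangles means \<open>h v = 0\<close> and \<open>\<Sigma>u h = 0\<close>; in particular \<open>h = \<phi> w\<close> for
  some \<open>\<phi>\<close>. All conditions are compared with \<open>h = w \<theta> w\<close>.

  Toda bracket: the cone of \<open>v\<close> is \<open>\<Sigma>X\<close>, so zero lies in the bracket iff some \<open>\<phi>\<close> with \<open>h = \<phi> w\<close> is killed
  by \<open>\<Sigma>u\<close>, that is, has the form \<open>w \<theta>\<close>.

  Verdier good: the cone \<open>A\<close> of \<open>v u = 0\<close> splits as \<open>Z \<oplus> \<Sigma>X\<close>. In any octahedra the maps have the shape
  \<open>\<alpha>\<^sub>1 = (1 + \<theta>\<^sub>1 w, w)\<close> and \<open>\<beta>\<^sub>2 = (w, - 1 + w \<theta>\<^sub>2)\<close>, so that \<open>\<beta>\<^sub>2 \<alpha>\<^sub>1 = w (\<theta>\<^sub>1 + \<theta>\<^sub>2) w\<close>. Conversely \<open>\<theta>\<close>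
  gives an automorphism of \<open>A\<close> that twists one octahedron into another with \<open>\<beta>\<^sub>2 \<alpha>\<^sub>1 = w \<theta> w\<close>.

  Good: up to automorphisms the cone starts with \<open>v \<oplus> v\<close>. If it is exact, the map to the rotated
  triangle that starts with \<open>(1, 1)\<close> and \<open>(1, 0)\<close> is completed by some \<open>(1 + w \<alpha>, w \<beta>)\<close>, and commutativity
  reads \<open>h = w (\<beta> - \<alpha> \<phi>) w\<close>. If \<open>h = w \<theta> w\<close>, then \<open>\<theta>\<close> provides the comparison of the cone with an exact
  triangle.
\<close>

section \<open>Additive categories\<close>

context category
begin

text \<open>Typing is done by rewriting: hom-set membership is split into facts about
  \<open>Arr\<close>, \<open>Dom\<close> and \<open>Cod\<close>, from which the simplifier
  discharges the side conditions of the rules below.\<close>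

lemma Hom_iff: "f \<in> Hom T X Y \<longleftrightarrow> f \<in> Arr T \<and> Dom T f = X \<and> Cod T f = Y"
  by (simp add: Hom_def)

lemma arr_facts [simp]:
  assumes "f \<in> Arr T"
  shows "Dom T f \<in> Ob T" "Cod T f \<in> Ob T"
  using assms Dom_in_Ob Cod_in_Ob by auto

lemma ident_facts [simp]:
  assumes "X \<in> Ob T"
  shows "Ident T X \<in> Arr T" "Dom T (Ident T X) = X" "Cod T (Ident T X) = X"
  using Ident_in_Hom[OF assms] by (auto simp: Hom_iff)

lemma comp_facts [simp]:
  assumes "f \<in> Arr T" "g \<in> Arr T" "Cod T f = Dom T g"
  shows "g \<cdot> f \<in> Arr T" "Dom T (g \<cdot> f) = Dom T f" "Cod T (g \<cdot> f) = Cod T g"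
  using Comp_in_Hom[of f "Dom T f" "Cod T f" g "Cod T g"] assms by (auto simp: Hom_iff)

lemma comp_assoc [simp]:
  assumes "f \<in> Arr T" "g \<in> Arr T" "h \<in> Arr T" "Cod T f = Dom T g" "Cod T g = Dom T h"
  shows "(h \<cdot> g) \<cdot> f = h \<cdot> (g \<cdot> f)"
  by (rule Comp_assoc[of f "Dom T f" "Dom T g" g "Dom T h" h "Cod T h"])
    (use assms in \<open>auto simp: Hom_iff\<close>)

lemma comp_ident [simp]:
  assumes "f \<in> Arr T" "Dom T f = X"
  shows "f \<cdot> Ident T X = f"
  by (rule Comp_Ident[of f X "Cod T f"]) (use assms in \<open>auto simp: Hom_iff\<close>)

lemma ident_comp [simp]:
  assumes "f \<in> Arr T" "Cod T f = X"
  shows "Ident T X \<cdot> f = f"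
  by (rule Ident_Comp[of f "Dom T f" X]) (use assms in \<open>auto simp: Hom_iff\<close>)

text \<open>Composites are normalised to the right, so an equation for \<open>g \<cdot> f\<close>
  stops matching once \<open>f\<close> is precomposed with something. This form applies inside the
  longer composite.\<close>

lemma comp_eq_comp:
  assumes "g \<cdot> f = k" "f \<in> Arr T" "g \<in> Arr T" "Cod T f = Dom T g" "x \<in> Arr T" "Cod T x = Dom T f"
  shows "g \<cdot> (f \<cdot> x) = k \<cdot> x"
  using assms by (metis comp_assoc)

lemma iso_arrI:
  assumes "f \<in> Hom T X Y" "g \<in> Hom T Y X" "g \<cdot> f = Ident T X" "f \<cdot> g = Ident T Y"
  shows "iso_arr T f"
  using assms by (auto simp: iso_arr_def Hom_iff)

lemma iso_arr_Ident: "X \<in> Ob T \<Longrightarrow> iso_arr T (Ident T X)"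
  by (rule iso_arrI[of _ X X "Ident T X"]) (auto simp: Hom_iff)

end

section \<open>Arithmetic of sums, negatives and zero maps\<close>

context additive_category
begin

lemma zero_facts [simp]:
  assumes "X \<in> Ob T" "Y \<in> Ob T"
  shows "Zero T X Y \<in> Arr T" "Dom T (Zero T X Y) = X" "Cod T (Zero T X Y) = Y"
proof -
  interpret G: comm_group "Hom_group T X Y" by (rule Hom_comm_group[OF assms])
  show "Zero T X Y \<in> Arr T" "Dom T (Zero T X Y) = X" "Cod T (Zero T X Y) = Y"
    using G.one_closed by (auto simp: Hom_group_def Hom_iff)
qed

lemma add_facts [simp]:
  assumes "f \<in> Arr T" "g \<in> Arr T" "Dom T g = Dom T f" "Cod T g = Cod T f"
  shows "f \<oplus> g \<in> Arr T" "Dom T (f \<oplus> g) = Dom T f" "Cod T (f \<oplus> g) = Cod T f"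
proof -
  interpret G: comm_group "Hom_group T (Dom T f) (Cod T f)" using assms by (simp add: Hom_comm_group)
  show "f \<oplus> g \<in> Arr T" "Dom T (f \<oplus> g) = Dom T f" "Cod T (f \<oplus> g) = Cod T f"
    using G.m_closed[of f g] assms by (auto simp: Hom_group_def Hom_iff)
qed

lemma neg_facts [simp]:
  assumes "f \<in> Arr T"
  shows "\<ominus> f \<in> Arr T" "Dom T (\<ominus> f) = Dom T f" "Cod T (\<ominus> f) = Cod T f"
proof -
  interpret G: comm_group "Hom_group T (Dom T f) (Cod T f)" using assms by (simp add: Hom_comm_group)
  show "\<ominus> f \<in> Arr T" "Dom T (\<ominus> f) = Dom T f" "Cod T (\<ominus> f) = Cod T f"
    using G.inv_closed[of f] assms by (auto simp: Hom_group_def Hom_iff neg_def)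
qed

lemma add_zero [simp]:
  assumes "f \<in> Arr T" "Dom T f = X" "Cod T f = Y"
  shows "f \<oplus> Zero T X Y = f" "Zero T X Y \<oplus> f = f"
proof -
  interpret G: comm_group "Hom_group T X Y" using assms by (auto intro!: Hom_comm_group)
  show "f \<oplus> Zero T X Y = f" "Zero T X Y \<oplus> f = f"
    using G.r_one[of f] G.l_one[of f] assms by (auto simp: Hom_group_def Hom_iff)
qed

lemma add_neg [simp]:
  assumes "f \<in> Arr T"
  shows "f \<oplus> \<ominus> f = Zero T (Dom T f) (Cod T f)" "\<ominus> f \<oplus> f = Zero T (Dom T f) (Cod T f)"
proof -
  interpret G: comm_group "Hom_group T (Dom T f) (Cod T f)" using assms by (simp add: Hom_comm_group)
  show "f \<oplus> \<ominus> f = Zero T (Dom T f) (Cod T f)" "\<ominus> f \<oplus> f = Zero T (Dom T f) (Cod T f)"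
    using G.r_inv[of f] G.l_inv[of f] assms by (auto simp: Hom_group_def Hom_iff neg_def)
qed

lemma add_assoc:
  assumes "f \<in> Arr T" "g \<in> Arr T" "k \<in> Arr T" "Dom T g = Dom T f" "Cod T g = Cod T f"
    "Dom T k = Dom T f" "Cod T k = Cod T f"
  shows "(f \<oplus> g) \<oplus> k = f \<oplus> (g \<oplus> k)"
proof -
  interpret G: comm_group "Hom_group T (Dom T f) (Cod T f)" using assms by (simp add: Hom_comm_group)
  show ?thesis
    using G.m_assoc[of f g k] assms by (auto simp: Hom_group_def Hom_iff)
qed

lemma add_commute:
  assumes "f \<in> Arr T" "g \<in> Arr T" "Dom T g = Dom T f" "Cod T g = Cod T f"
  shows "f \<oplus> g = g \<oplus> f"
proof -
  interpret G: comm_group "Hom_group T (Dom T f) (Cod T f)" using assms by (simp add: Hom_comm_group)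
  show ?thesis
    using G.m_comm[of f g] assms by (auto simp: Hom_group_def Hom_iff)
qed

lemma add_left_commute:
  assumes "f \<in> Arr T" "g \<in> Arr T" "k \<in> Arr T" "Dom T g = Dom T f" "Cod T g = Cod T f"
    "Dom T k = Dom T f" "Cod T k = Cod T f"
  shows "f \<oplus> (g \<oplus> k) = g \<oplus> (f \<oplus> k)"
  using assms by (metis add_assoc add_commute)

lemmas add_ac = add_assoc add_commute add_left_commute

lemma add_neg_cancel [simp]:
  assumes "f \<in> Arr T" "g \<in> Arr T" "Dom T g = Dom T f" "Cod T g = Cod T f"
  shows "f \<oplus> (\<ominus> f \<oplus> g) = g" "\<ominus> f \<oplus> (f \<oplus> g) = g"
  using add_assoc[of f "\<ominus> f" g] add_assoc[of "\<ominus> f" f g] assms by simp_all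

lemma neg_unique:
  assumes "f \<in> Arr T" "g \<in> Arr T" "Dom T g = Dom T f" "Cod T g = Cod T f"
    "f \<oplus> g = Zero T (Dom T f) (Cod T f)"
  shows "\<ominus> f = g"
proof -
  have "\<ominus> f = \<ominus> f \<oplus> (f \<oplus> g)" using assms(1) by (simp add: assms(5))
  also have "\<dots> = g" using assms(1-4) by simp
  finally show ?thesis .
qed

lemma neg_neg [simp]: "f \<in> Arr T \<Longrightarrow> \<ominus> (\<ominus> f) = f"
  by (rule neg_unique) auto

lemma neg_eq_neg_iff [simp]: "f \<in> Arr T \<Longrightarrow> g \<in> Arr T \<Longrightarrow> \<ominus> f = \<ominus> g \<longleftrightarrow> f = g"
  using neg_neg by metis

lemma neg_zero [simp]: "X \<in> Ob T \<Longrightarrow> Y \<in> Ob T \<Longrightarrow> \<ominus> (Zero T X Y) = Zero T X Y"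
  by (rule neg_unique) auto

lemma neg_eq_zero_iff [simp]:
  assumes "f \<in> Arr T" "X \<in> Ob T" "Y \<in> Ob T"
  shows "\<ominus> f = Zero T X Y \<longleftrightarrow> f = Zero T X Y"
  using neg_eq_neg_iff[of f "Zero T X Y"] assms by simp

lemma neg_add [simp]:
  assumes "f \<in> Arr T" "g \<in> Arr T" "Dom T g = Dom T f" "Cod T g = Cod T f"
  shows "\<ominus> (f \<oplus> g) = \<ominus> f \<oplus> \<ominus> g"
proof (rule neg_unique)
  have "f \<oplus> g \<oplus> (\<ominus> f \<oplus> \<ominus> g) = f \<oplus> (\<ominus> f \<oplus> (g \<oplus> \<ominus> g))"
    using assms by (simp add: add_assoc add_left_commute[of g "\<ominus> f"] del: add_neg add_neg_cancel)
  then show "f \<oplus> g \<oplus> (\<ominus> f \<oplus> \<ominus> g) = Zero T (Dom T (f \<oplus> g)) (Cod T (f \<oplus> g))"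
    using assms by simp
qed (use assms in auto)

lemma comp_add [simp]:
  assumes "f \<in> Arr T" "f' \<in> Arr T" "g \<in> Arr T" "Dom T f' = Dom T f" "Cod T f' = Cod T f"
    "Cod T f = Dom T g"
  shows "g \<cdot> (f \<oplus> f') = g \<cdot> f \<oplus> g \<cdot> f'"
  by (rule Comp_Add[of _ "Dom T f" "Dom T g" _ _ "Cod T g"]) (use assms in \<open>auto simp: Hom_iff\<close>)

lemma add_comp [simp]:
  assumes "f \<in> Arr T" "g \<in> Arr T" "g' \<in> Arr T" "Dom T g' = Dom T g" "Cod T g' = Cod T g"
    "Cod T f = Dom T g"
  shows "(g \<oplus> g') \<cdot> f = g \<cdot> f \<oplus> g' \<cdot> f"
  by (rule Add_Comp[of _ "Dom T f" "Dom T g" _ "Cod T g"]) (use assms in \<open>auto simp: Hom_iff\<close>)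

text \<open>Cancel one copy of \<open>f\<close>. Additive operations preserve zero by this argument,
  because the image of zero is its own double.\<close>

lemma add_self_eq_zero:
  assumes "f \<in> Arr T" "f \<oplus> f = f"
  shows "f = Zero T (Dom T f) (Cod T f)"
  using add_neg_cancel(2)[of f f] assms by simp

lemma comp_zero [simp]:
  assumes "g \<in> Arr T" "Dom T g = Y" "X \<in> Ob T"
  shows "g \<cdot> Zero T X Y = Zero T X (Cod T g)"
proof -
  have "g \<cdot> Zero T X Y \<oplus> g \<cdot> Zero T X Y = g \<cdot> (Zero T X Y \<oplus> Zero T X Y)"
    using assms by (subst comp_add) auto
  also have "\<dots> = g \<cdot> Zero T X Y"
    using assms by (subst add_zero) auto
  finally show ?thesis
    using add_self_eq_zero[of "g \<cdot> Zero T X Y"] assms by fastforce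
qed

lemma zero_comp [simp]:
  assumes "f \<in> Arr T" "Cod T f = Y" "Z \<in> Ob T"
  shows "Zero T Y Z \<cdot> f = Zero T (Dom T f) Z"
proof -
  have "Zero T Y Z \<cdot> f \<oplus> Zero T Y Z \<cdot> f = (Zero T Y Z \<oplus> Zero T Y Z) \<cdot> f"
    using assms by (subst add_comp) auto
  also have "\<dots> = Zero T Y Z \<cdot> f"
    using assms by (subst add_zero) auto
  finally show ?thesis
    using add_self_eq_zero[of "Zero T Y Z \<cdot> f"] assms by fastforce
qed

lemma comp_neg [simp]:
  assumes "f \<in> Arr T" "g \<in> Arr T" "Cod T f = Dom T g"
  shows "g \<cdot> \<ominus> f = \<ominus> (g \<cdot> f)"
proof (rule sym, rule neg_unique)
  have "g \<cdot> f \<oplus> g \<cdot> \<ominus> f = g \<cdot> (f \<oplus> \<ominus> f)"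
    using assms by (subst comp_add) auto
  then show "g \<cdot> f \<oplus> g \<cdot> \<ominus> f = Zero T (Dom T (g \<cdot> f)) (Cod T (g \<cdot> f))"
    using assms by simp
qed (use assms in auto)

lemma neg_comp [simp]:
  assumes "f \<in> Arr T" "g \<in> Arr T" "Cod T f = Dom T g"
  shows "(\<ominus> g) \<cdot> f = \<ominus> (g \<cdot> f)"
proof (rule sym, rule neg_unique)
  have "g \<cdot> f \<oplus> (\<ominus> g) \<cdot> f = (g \<oplus> \<ominus> g) \<cdot> f"
    using assms by (subst add_comp) auto
  then show "g \<cdot> f \<oplus> (\<ominus> g) \<cdot> f = Zero T (Dom T (g \<cdot> f)) (Cod T (g \<cdot> f))"
    using assms by simp
qed (use assms in auto)

lemma eq_add_iff:
  assumes "f \<in> Hom T X Y" "g \<in> Hom T X Y" "k \<in> Hom T X Y"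
  shows "f = g \<oplus> k \<longleftrightarrow> f \<oplus> \<ominus> g = k"
proof -
  have "\<ominus> g \<oplus> (g \<oplus> k) = k" "g \<oplus> (\<ominus> g \<oplus> f) = f" "f \<oplus> \<ominus> g = \<ominus> g \<oplus> f"
    using assms by (auto simp: Hom_iff intro: add_commute)
  then show ?thesis by metis
qed

lemma add_neg_eq_zero_iff:
  assumes "f \<in> Hom T X Y" "g \<in> Hom T X Y"
  shows "f \<oplus> \<ominus> g = Zero T X Y \<longleftrightarrow> f = g"
proof -
  have "Zero T X Y \<in> Hom T X Y" "g \<oplus> Zero T X Y = g"
    using assms by (auto simp: Hom_iff)
  with eq_add_iff[OF assms] show ?thesis by metis
qed

text \<open>Every map from or to \<open>N\<close> factors through the identity of \<open>N\<close>,
  so it vanishes when that identity does.\<close>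

lemma zero_objectI:
  assumes "N \<in> Ob T" "Ident T N = Zero T N N"
  shows "zero_object T N"
proof -
  have "f = Zero T N X" if "f \<in> Hom T N X" for f X
    using that assms comp_ident[of f N] comp_zero[of f N N] by (auto simp: Hom_iff)
  moreover have "f = Zero T X N" if "f \<in> Hom T X N" for f X
    using that assms ident_comp[of f N] zero_comp[of f N N] by (auto simp: Hom_iff)
  ultimately show ?thesis
    unfolding zero_object_def using assms(1) by (metis Hom_iff zero_facts)
qed

lemma zero_object_Ident:
  assumes "zero_object T N"
  shows "Ident T N = Zero T N N"
  using assms unfolding zero_object_def by (metis Hom_iff ident_facts zero_facts)

end

section \<open>Biproducts and matrices\<close>

locale biproduct = additive_category T
  for T :: "('o, 'm, 'z) additive_category_scheme" (structure) +
  fixes X Y P :: 'o and i1 i2 p1 p2 :: 'm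
  assumes i1_Hom: "i1 \<in> Hom T X P" and i2_Hom: "i2 \<in> Hom T Y P"
    and p1_Hom: "p1 \<in> Hom T P X" and p2_Hom: "p2 \<in> Hom T P Y"
    and proj_incl: "p1 \<cdot> i1 = Ident T X" "p2 \<cdot> i2 = Ident T Y"
      "p1 \<cdot> i2 = Zero T Y X" "p2 \<cdot> i1 = Zero T X Y"
    and incl_proj: "i1 \<cdot> p1 \<oplus> i2 \<cdot> p2 = Ident T P"
begin

lemmas biproduct_facts [simp] = i1_Hom[unfolded Hom_iff] i2_Hom[unfolded Hom_iff]
  p1_Hom[unfolded Hom_iff] p2_Hom[unfolded Hom_iff] proj_incl proj_incl[THEN comp_eq_comp]

lemma biproduct_obs [simp]: "X \<in> Ob T" "Y \<in> Ob T" "P \<in> Ob T"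
  using arr_facts[of p1] arr_facts[of p2] by simp_all

text \<open>Composing with the decomposition \<open>incl_proj\<close> of the identity recovers a map
  out of \<open>P\<close> from its two columns.\<close>

lemma eq_from_biproduct:
  assumes "f \<in> Hom T P W" "g \<in> Hom T P W" "f \<cdot> i1 = g \<cdot> i1" "f \<cdot> i2 = g \<cdot> i2"
  shows "f = g"
proof -
  have *: "k = (k \<cdot> i1) \<cdot> p1 \<oplus> (k \<cdot> i2) \<cdot> p2" if "k \<in> Hom T P W" for k
  proof -
    have "k = k \<cdot> (i1 \<cdot> p1 \<oplus> i2 \<cdot> p2)" unfolding incl_proj using that by (simp add: Hom_iff)
    also have "\<dots> = (k \<cdot> i1) \<cdot> p1 \<oplus> (k \<cdot> i2) \<cdot> p2" using that by (simp add: Hom_iff)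
    finally show ?thesis .
  qed
  show ?thesis using *[OF assms(1)] *[OF assms(2)] assms(3,4) by simp
qed

lemma eq_to_biproduct:
  assumes "f \<in> Hom T W P" "g \<in> Hom T W P" "p1 \<cdot> f = p1 \<cdot> g" "p2 \<cdot> f = p2 \<cdot> g"
  shows "f = g"
proof -
  have *: "k = i1 \<cdot> (p1 \<cdot> k) \<oplus> i2 \<cdot> (p2 \<cdot> k)" if "k \<in> Hom T W P" for k
  proof -
    have "k = (i1 \<cdot> p1 \<oplus> i2 \<cdot> p2) \<cdot> k" unfolding incl_proj using that by (simp add: Hom_iff)
    also have "\<dots> = i1 \<cdot> (p1 \<cdot> k) \<oplus> i2 \<cdot> (p2 \<cdot> k)" using that by (simp add: Hom_iff)
    finally show ?thesis .
  qed
  show ?thesis using *[OF assms(1)] *[OF assms(2)] assms(3,4) by simp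
qed

end

context additive_category
begin

lemma biprod_biproduct:
  assumes "X \<in> Ob T" "Y \<in> Ob T"
  obtains P i1 i2 p1 p2 where "biprod T X Y = (i1, i2, p1, p2)" "biproduct T X Y P i1 i2 p1 p2"
proof -
  have B: "is_biproduct T X Y (biprod T X Y)"
    unfolding biprod_def using biproduct_exists[OF assms] by (rule someI_ex)
  obtain i1 i2 p1 p2 where eq: "biprod T X Y = (i1, i2, p1, p2)" by (metis prod_cases4)
  obtain P where "biproduct T X Y P i1 i2 p1 p2"
    using B additive_category_axioms unfolding eq is_biproduct_def biproduct_def biproduct_axioms_def
    by auto
  with eq that show ?thesis by blast
qed

text \<open>All matrix computations below go through these rows and columns. The biproduct data are
  arbitrary because the last sum of a cone carries suspended inclusions rather than chosen
  ones.\<close>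

lemma matrix_map_facts:
  assumes "biproduct T A B P i1 i2 p1 p2" "biproduct T C D Q j1 j2 q1 q2"
    and "a \<in> Hom T A C" "b \<in> Hom T B C" "c \<in> Hom T A D" "d \<in> Hom T B D"
    and M: "M = matrix_map T (p1, p2) (j1, j2) ((a, b), (c, d))"
  shows "M \<in> Hom T P Q"
    and "M \<cdot> i1 = j1 \<cdot> a \<oplus> j2 \<cdot> c" "M \<cdot> i2 = j1 \<cdot> b \<oplus> j2 \<cdot> d"
    and "q1 \<cdot> M = a \<cdot> p1 \<oplus> b \<cdot> p2" "q2 \<cdot> M = c \<cdot> p1 \<oplus> d \<cdot> p2"
proof -
  interpret B: biproduct T A B P i1 i2 p1 p2 by fact
  interpret B': biproduct T C D Q j1 j2 q1 q2 by fact
  note [simp] = assms(3-6)[unfolded Hom_iff]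
  have M': "M = j1 \<cdot> (a \<cdot> p1 \<oplus> b \<cdot> p2) \<oplus> j2 \<cdot> (c \<cdot> p1 \<oplus> d \<cdot> p2)"
    by (simp add: M matrix_map_def)
  show "M \<in> Hom T P Q"
    "M \<cdot> i1 = j1 \<cdot> a \<oplus> j2 \<cdot> c" "M \<cdot> i2 = j1 \<cdot> b \<oplus> j2 \<cdot> d"
    "q1 \<cdot> M = a \<cdot> p1 \<oplus> b \<cdot> p2" "q2 \<cdot> M = c \<cdot> p1 \<oplus> d \<cdot> p2"
    unfolding M' by (simp_all add: Hom_iff)
qed

end

section \<open>Triangulated categories\<close>

context triangulated_category
begin

lemmas [simp] = Susp_in_Ob susp_Ident

lemma susp_facts [simp]:
  assumes "f \<in> Arr T"
  shows "susp T f \<in> Arr T" "Dom T (susp T f) = Susp T (Dom T f)"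
    "Cod T (susp T f) = Susp T (Cod T f)"
proof -
  have "bij_betw (susp T) (Hom T (Dom T f) (Cod T f)) (Hom T (Susp T (Dom T f)) (Susp T (Cod T f)))"
    using assms by (simp add: susp_bij)
  then have "susp T f \<in> Hom T (Susp T (Dom T f)) (Susp T (Cod T f))"
    using assms by (auto simp: bij_betw_def Hom_iff)
  then show "susp T f \<in> Arr T" "Dom T (susp T f) = Susp T (Dom T f)"
    "Cod T (susp T f) = Susp T (Cod T f)"
    by (auto simp: Hom_iff)
qed

lemma susp_comp [simp]:
  assumes "f \<in> Arr T" "g \<in> Arr T" "Cod T f = Dom T g"
  shows "susp T (g \<cdot> f) = susp T g \<cdot> susp T f"
  by (rule susp_Comp[of _ "Dom T f" "Dom T g" _ "Cod T g"]) (use assms in \<open>auto simp: Hom_iff\<close>)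

lemma susp_add [simp]:
  assumes "f \<in> Arr T" "g \<in> Arr T" "Dom T g = Dom T f" "Cod T g = Cod T f"
  shows "susp T (f \<oplus> g) = susp T f \<oplus> susp T g"
  by (rule susp_Add[of _ "Dom T f" "Cod T f"]) (use assms in \<open>auto simp: Hom_iff\<close>)

lemma susp_zero [simp]:
  assumes "X \<in> Ob T" "Y \<in> Ob T"
  shows "susp T (Zero T X Y) = Zero T (Susp T X) (Susp T Y)"
proof -
  have "susp T (Zero T X Y) \<oplus> susp T (Zero T X Y) = susp T (Zero T X Y)"
    using susp_add[of "Zero T X Y" "Zero T X Y"] assms by simp
  then show ?thesis
    using add_self_eq_zero[of "susp T (Zero T X Y)"] assms by simp
qed

lemma susp_neg [simp]:
  assumes "f \<in> Arr T"
  shows "susp T (\<ominus> f) = \<ominus> susp T f"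
proof (rule sym, rule neg_unique)
  have "susp T f \<oplus> susp T (\<ominus> f) = susp T (f \<oplus> \<ominus> f)"
    using assms by (subst susp_add) auto
  then show "susp T f \<oplus> susp T (\<ominus> f) = Zero T (Dom T (susp T f)) (Cod T (susp T f))"
    using assms by simp
qed (use assms in auto)

lemma susp_full:
  assumes "g \<in> Hom T (Susp T X) (Susp T Y)" "X \<in> Ob T" "Y \<in> Ob T"
  obtains f where "f \<in> Hom T X Y" "g = susp T f"
  using susp_bij[OF assms(2,3)] assms(1) by (auto simp: bij_betw_def)

lemma susp_faithful:
  assumes "f \<in> Hom T X Y" "g \<in> Hom T X Y" "susp T f = susp T g"
  shows "f = g"
proof -
  have "X \<in> Ob T" "Y \<in> Ob T" using assms by (auto simp: Hom_iff)
  from susp_bij[OF this] have "inj_on (susp T) (Hom T X Y)" by (simp add: bij_betw_def)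
  then show ?thesis using assms by (meson inj_onD)
qed

lemma desusp_susp: "f \<in> Hom T X Y \<Longrightarrow> desusp T X Y (susp T f) = f"
  unfolding desusp_def by (rule the_inv_into_f_f) (blast intro: inj_onI susp_faithful)

lemma zero_object_Susp:
  assumes "zero_object T N"
  shows "zero_object T (Susp T N)"
proof (rule zero_objectI)
  have N: "N \<in> Ob T" using assms by (simp add: zero_object_def)
  then show "Susp T N \<in> Ob T" by simp
  show "Ident T (Susp T N) = Zero T (Susp T N) (Susp T N)"
    using zero_object_Ident[OF assms] N by (metis susp_Ident susp_zero)
qed

text \<open>The biproduct equations only involve composites, sums, identities and zeros, all
  preserved by \<Sigma>. This makes \<open>Susp T P\<close> the direct sum in which a mapping cone
  ends.\<close>

lemma biproduct_susp:
  assumes "biproduct T X Y P i1 i2 p1 p2"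
  shows "biproduct T (Susp T X) (Susp T Y) (Susp T P) (susp T i1) (susp T i2) (susp T p1) (susp T p2)"
proof -
  interpret B: biproduct T X Y P i1 i2 p1 p2 by fact
  show ?thesis
  proof
    have "susp T (i1 \<cdot> p1 \<oplus> i2 \<cdot> p2) = Ident T (Susp T P)" by (simp only: B.incl_proj susp_Ident B.biproduct_obs)
    then show "susp T i1 \<cdot> susp T p1 \<oplus> susp T i2 \<cdot> susp T p2 = Ident T (Susp T P)" by simp
  qed (simp_all add: Hom_iff flip: susp_comp)
qed

section \<open>Weak kernels, weak cokernels and a criterion for exactness\<close>

lemma exact_Hom:
  assumes "(u, v, w) \<in> Exact T"
  obtains X Y Z where "u \<in> Hom T X Y" "v \<in> Hom T Y Z" "w \<in> Hom T Z (Susp T X)"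
  using Exact_candidate[OF assms] by (auto simp: candidate_triangle_def)

lemma exact_rotate:
  assumes "(u, v, w) \<in> Exact T"
  shows "(v, w, \<ominus> susp T u) \<in> Exact T"
  using Exact_rotate Exact_candidate assms by blast

lemma exact_fill:
  assumes "(u, v, w) \<in> Exact T" "(u', v', w') \<in> Exact T"
    "f \<in> Hom T (Dom T u) (Dom T u')" "g \<in> Hom T (Dom T v) (Dom T v')" "g \<cdot> u = u' \<cdot> f"
  obtains k where "k \<in> Hom T (Dom T w) (Dom T w')" "k \<cdot> v = v' \<cdot> g" "w' \<cdot> k = susp T f \<cdot> w"
proof -
  have "Cod T u = Dom T v" "Cod T u' = Dom T v'"
    using exact_Hom[OF assms(1)] exact_Hom[OF assms(2)] by (metis Hom_iff)+
  then obtain k where "triangle_map T (u, v, w) (u', v', w') (f, g, k)"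
    using Exact_fill[OF assms(1-3)] assms(4,5) by metis
  then show ?thesis using that[of k] by (auto simp: triangle_map_def)
qed

text \<open>Compare the trivial triangle on \<open>X\<close> with the given one, starting from the
  identity and \<open>u\<close>: the filled-in map factors \<open>v \<cdot> u\<close> through a zero
  object.\<close>

lemma exact_comp_zero:
  assumes "(u, v, w) \<in> Exact T"
  shows "v \<cdot> u = Zero T (Dom T u) (Cod T v)"
proof -
  obtain X Y Z where uvw: "u \<in> Hom T X Y" "v \<in> Hom T Y Z" "w \<in> Hom T Z (Susp T X)"
    using exact_Hom[OF assms] .
  obtain N where N: "zero_object T N" using zero_object_exists by blast
  have ob: "X \<in> Ob T" "N \<in> Ob T" using uvw N by (auto simp: Hom_iff zero_object_def)
  obtain k where "k \<in> Hom T N Z" "k \<cdot> Zero T X N = v \<cdot> u"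
    using exact_fill[OF Exact_Ident[OF ob(1) N] assms, of "Ident T X" u] uvw ob
    by (auto simp: Hom_iff)
  then show ?thesis using uvw ob by (auto simp: Hom_iff)
qed

text \<open>Rotate the trivial triangle on \<open>W\<close> and the given triangle, and complete
  \<open>x\<close> and zero to a map of triangles. Its third component goes from
  \<open>Susp T W\<close> to \<open>Susp T X\<close> and desuspends to the lift.\<close>

lemma weak_kernel:
  assumes ex: "(u, v, w) \<in> Exact T" and x: "x \<in> Hom T W (Dom T v)" "v \<cdot> x = Zero T W (Cod T v)"
  obtains y where "y \<in> Hom T W (Dom T u)" "x = u \<cdot> y"
proof -
  obtain X Y Z where uvw: "u \<in> Hom T X Y" "v \<in> Hom T Y Z" "w \<in> Hom T Z (Susp T X)"
    using exact_Hom[OF ex] .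
  obtain N where N: "zero_object T N" using zero_object_exists by blast
  have [simp]: "X \<in> Ob T" "W \<in> Ob T" "N \<in> Ob T" "Z \<in> Ob T"
    using uvw N x(1) by (auto simp: Hom_iff zero_object_def)
  note [simp] = uvw[unfolded Hom_iff]
  have [simp]: "x \<in> Arr T" "Dom T x = W" "Cod T x = Y" using x(1) by (auto simp: Hom_iff)
  obtain k where k: "k \<in> Hom T (Susp T W) (Susp T X)" "(\<ominus> susp T u) \<cdot> k = susp T x \<cdot> \<ominus> susp T (Ident T W)"
    using exact_fill[OF exact_rotate[OF Exact_Ident[OF _ N]] exact_rotate[OF ex], of W x "Zero T N Z"] x(2)
    by (auto simp: Hom_iff)
  obtain y where y: "y \<in> Hom T W X" "k = susp T y" using susp_full[OF k(1)] by auto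
  note [simp] = y(1)[unfolded Hom_iff]
  \<comment> \<open>Rotation put the same sign on both sides, so the signs cancel.\<close>
  have "susp T (u \<cdot> y) = susp T x" using k(2) by (simp add: y(2))
  then have "x = u \<cdot> y" by (intro susp_faithful[of x W Y]) (simp_all add: Hom_iff)
  with that[of y] show ?thesis by (simp add: Hom_iff)
qed

text \<open>The comparison now goes to the triangle on \<open>N\<close>, \<open>W\<close>,
  \<open>W\<close> whose middle map is the identity; the third component is the
  factorisation.\<close>

lemma weak_cokernel:
  assumes ex: "(u, v, w) \<in> Exact T" and x: "x \<in> Hom T (Dom T v) W" "x \<cdot> u = Zero T (Dom T u) W"
  obtains y where "y \<in> Hom T (Dom T w) W" "x = y \<cdot> v"
proof -
  obtain X Y Z where uvw: "u \<in> Hom T X Y" "v \<in> Hom T Y Z" "w \<in> Hom T Z (Susp T X)"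
    using exact_Hom[OF ex] .
  obtain N where N: "zero_object T N" using zero_object_exists by blast
  have [simp]: "X \<in> Ob T" "W \<in> Ob T" "N \<in> Ob T" "Z \<in> Ob T"
    using uvw N x(1) by (auto simp: Hom_iff zero_object_def)
  note [simp] = uvw[unfolded Hom_iff]
  have [simp]: "x \<in> Arr T" "Dom T x = Y" "Cod T x = W" using x(1) by (auto simp: Hom_iff)
  have "candidate_triangle T (Zero T N W, Ident T W, Zero T W (Susp T N))"
    by (simp add: candidate_triangle_def Hom_iff)
  \<comment> \<open>Its rotation is the trivial triangle on \<open>W\<close>, formed with the zero
    object \<open>Susp T N\<close>.\<close>
  then have "(Zero T N W, Ident T W, Zero T W (Susp T N)) \<in> Exact T"
    using Exact_Ident[OF _ zero_object_Susp[OF N], of W] by (simp add: Exact_rotate)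
  from exact_fill[OF ex this, of "Zero T X N" x] obtain k
    where "k \<in> Hom T Z W" "k \<cdot> v = x"
    using x(2) by (auto simp: Hom_iff)
  with that[of k] show ?thesis by simp
qed

text \<open>A diagram chase shows that \<open>\<phi>\<close> is a monomorphism with a section, hence an isomorphism onto an
  exact triangle.\<close>

lemma exact_of_weakly_exact:
  assumes ex: "(u, p, q) \<in> Exact T"
    and uvw: "u \<in> Hom T X Y" "v \<in> Hom T Y Z" "w \<in> Hom T Z (Susp T X)"
    and vu: "v \<cdot> u = Zero T X Z"
    and ker_w: "\<And>W x. \<lbrakk>x \<in> Hom T W Z; w \<cdot> x = Zero T W (Susp T X)\<rbrakk> \<Longrightarrow> \<exists>y \<in> Hom T W Y. x = v \<cdot> y"
    and ker_u: "\<And>W x. \<lbrakk>x \<in> Hom T W (Susp T X); susp T u \<cdot> x = Zero T W (Susp T Y)\<rbrakk>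
      \<Longrightarrow> \<exists>y \<in> Hom T W Z. x = w \<cdot> y"
    and \<phi>: "\<phi> \<in> Hom T Z (Cod T p)" "\<phi> \<cdot> v = p" "q \<cdot> \<phi> = w"
  shows "(u, v, w) \<in> Exact T"
proof -
  obtain C where pq: "p \<in> Hom T Y C" "q \<in> Hom T C (Susp T X)"
    using exact_Hom[OF ex] uvw by (metis Hom_iff)
  have ob [simp]: "X \<in> Ob T" "Y \<in> Ob T" "Z \<in> Ob T" "C \<in> Ob T" using uvw pq by (auto simp: Hom_iff)
  note [simp] = pq[unfolded Hom_iff] uvw[unfolded Hom_iff]
  have [simp]: "\<phi> \<in> Arr T" "Dom T \<phi> = Z" "Cod T \<phi> = C" using \<phi>(1) by (auto simp: Hom_iff)
  \<comment> \<open>If \<phi> kills \<open>x\<close>, so does \<open>w\<close>. Then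
    \<open>x\<close> lifts along \<open>v\<close>, the lift is killed by \<open>p\<close> and so
    lifts along \<open>u\<close>, and \<open>v \<cdot> u\<close> is zero.\<close>
  have mono: "x = Zero T W Z" if x: "x \<in> Hom T W Z" "\<phi> \<cdot> x = Zero T W C" for W x
  proof -
    have [simp]: "W \<in> Ob T" using x by (auto simp: Hom_iff)
    note [simp] = x(1)[unfolded Hom_iff]
    have "w \<cdot> x = Zero T W (Susp T X)"
      unfolding \<phi>(3)[symmetric] by (simp add: x)
    then obtain y where y: "y \<in> Hom T W Y" "x = v \<cdot> y" using ker_w x(1) by blast
    note [simp] = y(1)[unfolded Hom_iff]
    have "p \<cdot> y = Zero T W C"
      unfolding \<phi>(2)[symmetric] using x(2) by (simp add: y(2))
    then obtain z where z: "z \<in> Hom T W X" "y = u \<cdot> z"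
      using weak_kernel[OF ex, of y W] by (auto simp: Hom_iff)
    note [simp] = z(1)[unfolded Hom_iff]
    have "x = (v \<cdot> u) \<cdot> z" by (simp add: y(2) z(2))
    then show ?thesis unfolding vu by simp
  qed
  have "susp T u \<cdot> q = Zero T C (Susp T Y)"
    using exact_comp_zero[OF exact_rotate[OF exact_rotate[OF ex]]] by simp
  then obtain s where s: "s \<in> Hom T C Z" "q = w \<cdot> s" using ker_u pq(2) by blast
  note [simp] = s(1)[unfolded Hom_iff]
  have "q \<cdot> (\<phi> \<cdot> s \<oplus> \<ominus> Ident T C) = Zero T C (Susp T X)"
    by (simp add: comp_eq_comp[OF \<phi>(3)] flip: s(2))
  then obtain t where t: "t \<in> Hom T C Y" "\<phi> \<cdot> s \<oplus> \<ominus> Ident T C = p \<cdot> t"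
    using weak_kernel[OF exact_rotate[OF ex], of "\<phi> \<cdot> s \<oplus> \<ominus> Ident T C" C]
    by (auto simp: Hom_iff)
  note [simp] = t(1)[unfolded Hom_iff]
  \<comment> \<open>The lift \<open>s\<close> is a section of \<phi> up to the error
    \<open>p \<cdot> t\<close>. As \<open>p\<close> is \<open>\<phi> \<cdot> v\<close>, subtracting
    \<open>v \<cdot> t\<close> removes it.\<close>
  define r where "r = s \<oplus> \<ominus> (v \<cdot> t)"
  have r: "r \<in> Hom T C Z" unfolding r_def by (simp add: Hom_iff)
  note [simp] = r[unfolded Hom_iff]
  have "\<phi> \<cdot> s = Ident T C \<oplus> p \<cdot> t"
    using t(2) eq_add_iff[of "\<phi> \<cdot> s" C C "Ident T C" "p \<cdot> t"] by (simp add: Hom_iff)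
  moreover have "\<phi> \<cdot> r = \<phi> \<cdot> s \<oplus> \<ominus> (p \<cdot> t)"
    unfolding r_def by (simp add: comp_eq_comp[OF \<phi>(2)])
  ultimately have \<phi>r: "\<phi> \<cdot> r = Ident T C"
    by (simp add: add_assoc)
  \<comment> \<open>A section of a monomorphism is a two-sided inverse: \<phi> kills the
    difference.\<close>
  have "r \<cdot> \<phi> \<oplus> \<ominus> Ident T Z = Zero T Z Z"
    by (rule mono) (simp_all add: Hom_iff comp_eq_comp[OF \<phi>r])
  then have r\<phi>: "r \<cdot> \<phi> = Ident T Z"
    using add_neg_eq_zero_iff[of "r \<cdot> \<phi>" Z Z "Ident T Z"] by (simp add: Hom_iff)
  show ?thesis
  proof (rule Exact_iso[OF ex])
    show "candidate_triangle T (u, v, w)" using uvw by (auto simp: candidate_triangle_def)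
    have "r \<cdot> p = v" unfolding \<phi>(2)[symmetric] by (simp add: comp_eq_comp[OF r\<phi>])
    moreover have "w \<cdot> r = q" unfolding \<phi>(3)[symmetric] by (simp add: \<phi>r)
    ultimately show "triangle_map T (u, p, q) (u, v, w) (Ident T X, Ident T Y, r)"
      by (simp add: triangle_map_def Hom_iff)
    show "iso_arr T r" by (rule iso_arrI[of r C Z \<phi>]) (simp_all add: Hom_iff \<phi>r r\<phi>)
  qed (simp_all add: iso_arr_Ident)
qed

end

section \<open>Liftings along a fixed exact triangle, and its contractibility\<close>

locale exact_triangle = triangulated_category T
  for T :: "('o, 'm, 'z) triangulated_category_scheme" (structure) +
  fixes X Y Z :: 'o and u v w :: 'm
  assumes u_Hom: "u \<in> Hom T X Y" and v_Hom: "v \<in> Hom T Y Z" and w_Hom: "w \<in> Hom T Z (Susp T X)"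
    and exact: "(u, v, w) \<in> Exact T"
begin

lemmas uvw [simp] = u_Hom[unfolded Hom_iff] v_Hom[unfolded Hom_iff] w_Hom[unfolded Hom_iff]

lemma obs [simp]: "X \<in> Ob T" "Y \<in> Ob T" "Z \<in> Ob T"
  using arr_facts[of u] arr_facts[of v] by simp_all

lemma comp_eq_zero [simp]:
  "v \<cdot> u = Zero T X Z" "w \<cdot> v = Zero T Y (Susp T X)" "susp T u \<cdot> w = Zero T Z (Susp T Y)"
  using exact_comp_zero[OF exact] exact_comp_zero[OF exact_rotate[OF exact]]
    exact_comp_zero[OF exact_rotate[OF exact_rotate[OF exact]]]
  by simp_all

lemma susp_comp_eq_zero [simp]: "susp T v \<cdot> susp T u = Zero T (Susp T X) (Susp T Z)"
  using susp_comp[of u v] by simp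

lemmas comp_eq_zero_comp [simp] =
  comp_eq_zero[THEN comp_eq_comp] susp_comp_eq_zero[THEN comp_eq_comp]

lemma kernel_v:
  assumes "x \<in> Hom T W Y" "v \<cdot> x = Zero T W Z"
  obtains y where "y \<in> Hom T W X" "x = u \<cdot> y"
  using weak_kernel[OF exact, of x W] assms by auto

lemma kernel_w:
  assumes "x \<in> Hom T W Z" "w \<cdot> x = Zero T W (Susp T X)"
  obtains y where "y \<in> Hom T W Y" "x = v \<cdot> y"
  using weak_kernel[OF exact_rotate[OF exact], of x W] assms by auto

lemma kernel_susp_u:
  assumes "x \<in> Hom T W (Susp T X)" "susp T u \<cdot> x = Zero T W (Susp T Y)"
  obtains y where "y \<in> Hom T W Z" "x = w \<cdot> y"
proof -
  have "(\<ominus> susp T u) \<cdot> x = Zero T W (Susp T Y)" "W \<in> Ob T" using assms by (auto simp: Hom_iff)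
  then show ?thesis
    using weak_kernel[OF exact_rotate[OF exact_rotate[OF exact]], of x W] assms that by auto
qed

text \<open>After three rotations \<open>susp T u\<close> and \<open>susp T v\<close> both carry a
  sign. The sign on \<open>susp T v\<close> leaves the kernel unchanged; the one on
  \<open>susp T u\<close> is moved into the lift.\<close>

lemma kernel_susp_v:
  assumes "x \<in> Hom T W (Susp T Y)" "susp T v \<cdot> x = Zero T W (Susp T Z)"
  obtains y where "y \<in> Hom T W (Susp T X)" "x = susp T u \<cdot> y"
proof -
  have "(\<ominus> susp T v) \<cdot> x = Zero T W (Susp T Z)" "W \<in> Ob T" using assms by (auto simp: Hom_iff)
  then obtain y where "y \<in> Hom T W (Susp T X)" "x = (\<ominus> susp T u) \<cdot> y"
    using weak_kernel[OF exact_rotate[OF exact_rotate[OF exact_rotate[OF exact]]], of x W] assms that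
    by auto
  with that[of "\<ominus> y"] show ?thesis by (auto simp: Hom_iff)
qed

lemma cokernel_v:
  assumes "x \<in> Hom T Z W" "x \<cdot> v = Zero T Y W"
  obtains y where "y \<in> Hom T (Susp T X) W" "x = y \<cdot> w"
  using weak_cokernel[OF exact_rotate[OF exact], of x W] assms by auto

lemma cokernel_w:
  assumes "x \<in> Hom T (Susp T X) W" "x \<cdot> w = Zero T Z W"
  obtains y where "y \<in> Hom T (Susp T Y) W" "x = y \<cdot> susp T u"
proof -
  obtain y where "y \<in> Hom T (Susp T Y) W" "x = y \<cdot> \<ominus> susp T u"
    using weak_cokernel[OF exact_rotate[OF exact_rotate[OF exact]], of x W] assms by auto
  with that[of "\<ominus> y"] show ?thesis by (auto simp: Hom_iff)
qed

text \<open>The complements of the idempotents \<open>\<theta> \<cdot> w\<close> and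
  \<open>w \<cdot> \<theta>\<close> factor through \<open>v\<close> and \<open>susp T u\<close>. The
  factors give \<open>G\<close> and \<open>F\<close>, which with \<theta> as \<open>H\<close>
  satisfy the homotopy equations at \<open>X\<close> and \<open>Z\<close>; the remaining error at
  \<open>Y\<close> has square zero and is absorbed into \<open>G\<close>.\<close>

lemma contractible_if_flash:
  assumes \<theta>: "\<theta> \<in> Hom T (Susp T X) Z" "w = w \<cdot> \<theta> \<cdot> w"
  shows "contractible T (u, v, w)"
proof -
  note [simp] = \<theta>(1)[unfolded Hom_iff] \<theta>(2)[symmetric]
  have "Ident T Z \<oplus> \<ominus> (\<theta> \<cdot> w) \<in> Hom T Z Z"
    and "w \<cdot> (Ident T Z \<oplus> \<ominus> (\<theta> \<cdot> w)) = Zero T Z (Susp T X)" by (simp_all add: Hom_iff)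
  then obtain G where G: "G \<in> Hom T Z Y" "Ident T Z \<oplus> \<ominus> (\<theta> \<cdot> w) = v \<cdot> G"
    by (rule kernel_w)
  have "Ident T (Susp T X) \<oplus> \<ominus> (w \<cdot> \<theta>) \<in> Hom T (Susp T X) (Susp T X)"
    and "(Ident T (Susp T X) \<oplus> \<ominus> (w \<cdot> \<theta>)) \<cdot> w = Zero T Z (Susp T X)" by (simp_all add: Hom_iff)
  then obtain \<Phi> where \<Phi>: "\<Phi> \<in> Hom T (Susp T Y) (Susp T X)"
      "Ident T (Susp T X) \<oplus> \<ominus> (w \<cdot> \<theta>) = \<Phi> \<cdot> susp T u"
    by (rule cokernel_w)
  obtain F where F: "F \<in> Hom T Y X" "\<Phi> = susp T F" using susp_full[OF \<Phi>(1)] by auto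
  have "w \<cdot> \<theta> \<in> Hom T (Susp T X) (Susp T X)" by (simp add: Hom_iff)
  then obtain k where k: "k \<in> Hom T X X" "w \<cdot> \<theta> = susp T k" by (rule susp_full) auto
  note [simp] = G(1)[unfolded Hom_iff] F(1)[unfolded Hom_iff] k(1)[unfolded Hom_iff]
  have Z: "Ident T Z = \<theta> \<cdot> w \<oplus> v \<cdot> G"
    using G(2) eq_add_iff[of "Ident T Z" Z Z "\<theta> \<cdot> w" "v \<cdot> G"] by (simp add: Hom_iff)
  have "susp T (Ident T X \<oplus> \<ominus> k) = susp T (F \<cdot> u)"
    using \<Phi>(2) by (simp add: F(2) k(2))
  then have "Ident T X \<oplus> \<ominus> k = F \<cdot> u"
    by (rule susp_faithful[rotated 2]) (simp_all add: Hom_iff)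
  then have X: "Ident T X = F \<cdot> u \<oplus> k"
    using eq_add_iff[of "Ident T X" X X k "F \<cdot> u"] add_commute[of k "F \<cdot> u"] by (simp add: Hom_iff)
  have uk: "u \<cdot> k = Zero T X Y"
    by (rule susp_faithful) (simp_all add: Hom_iff flip: k(2))
  have vGv: "v \<cdot> G \<cdot> v = v"
    using arg_cong[OF Z, of "\<lambda>x. x \<cdot> v"] by simp
  have uFu: "u \<cdot> F \<cdot> u = u"
    using arg_cong[OF X, of "\<lambda>x. u \<cdot> x"] by (simp add: uk)
  \<comment> \<open>The error in the homotopy equation at \<open>Y\<close>. It is killed by
    \<open>v\<close>, hence factors through \<open>u\<close>, and it kills \<open>u\<close>; so its
    square is zero.\<close>
  define e where "e = Ident T Y \<oplus> (\<ominus> (G \<cdot> v) \<oplus> \<ominus> (u \<cdot> F))"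
  have e: "e \<in> Hom T Y Y" by (simp add: e_def Hom_iff)
  note [simp] = e[unfolded Hom_iff]
  have ve: "v \<cdot> e = Zero T Y Z" by (simp add: e_def vGv)
  have eu: "e \<cdot> u = Zero T X Y" by (simp add: e_def uFu)
  obtain a where a: "a \<in> Hom T Y X" "e = u \<cdot> a" using kernel_v[OF e ve] .
  note [simp] = a(1)[unfolded Hom_iff]
  have "e \<cdot> e = e \<cdot> u \<cdot> a" using a(2) by simp
  also have "\<dots> = Zero T Y Y" using comp_eq_comp[OF eu, of a] by simp
  \<comment> \<open>Expand the second factor of \<open>e \<cdot> e\<close>; the term ending in
    \<open>u \<cdot> F\<close> dies since \<open>e\<close> kills \<open>u\<close>.\<close>
  finally have "e \<oplus> \<ominus> (e \<cdot> G \<cdot> v) = Zero T Y Y"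
    using comp_eq_comp[OF eu, of F] by (subst (asm) (2) e_def) simp
  then have eGv: "e = e \<cdot> G \<cdot> v"
    using add_neg_eq_zero_iff[of e Y Y "e \<cdot> G \<cdot> v"] by (simp add: Hom_iff)
  text \<open>A homotopy from the identity to \<open>(0, e, 0)\<close>, composed with the map \<open>(1, 1 + e, 1)\<close>, is a
    homotopy from the identity to \<open>(0, e\<^sup>2, 0) = 0\<close>.\<close>
  define G' where "G' = G \<oplus> e \<cdot> G"
  have "Ident T X = F \<cdot> u \<oplus> desusp T X X (w \<cdot> \<theta>)"
    using X desusp_susp[OF k(1)] by (simp add: k(2))
  moreover have "Ident T Y = G' \<cdot> v \<oplus> u \<cdot> F"
  proof -
    have "G' \<cdot> v \<oplus> u \<cdot> F = G \<cdot> v \<oplus> e \<oplus> u \<cdot> F"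
      by (simp add: G'_def flip: eGv)
    also have "\<dots> = Ident T Y"
      by (simp add: e_def add_ac)
    finally show ?thesis by simp
  qed
  moreover have "Ident T Z = \<theta> \<cdot> w \<oplus> v \<cdot> G'"
    using Z comp_eq_comp[OF ve, of G] by (simp add: G'_def)
  moreover have "G' \<in> Hom T Z Y" by (simp add: G'_def Hom_iff)
  ultimately show ?thesis
    unfolding contractible_def nullhomotopic_def using F(1) \<theta>(1) by simp blast
qed

text \<open>For the forward direction, apply \<open>w\<close> to the homotopy equation at
  \<open>Z\<close>: the summand through \<open>v\<close> vanishes and
  \<open>w \<cdot> H \<cdot> w\<close> remains.\<close>

lemma contractible_iff_flash: "contractible T (u, v, w) \<longleftrightarrow> lightning_flash T (u, v, w) w"
proof
  assume "contractible T (u, v, w)"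
  then obtain G H where GH: "G \<in> Hom T Z Y" "H \<in> Hom T (Susp T X) Z" "Ident T Z = H \<cdot> w \<oplus> v \<cdot> G"
    unfolding contractible_def nullhomotopic_def by auto
  have "w = w \<cdot> Ident T Z" by simp
  also have "\<dots> = w \<cdot> H \<cdot> w" unfolding GH(3) using GH(1,2) by (simp add: Hom_iff)
  finally show "lightning_flash T (u, v, w) w"
    using GH(2) by (auto simp: lightning_flash_def)
next
  assume "lightning_flash T (u, v, w) w"
  then show "contractible T (u, v, w)"
    by (auto simp: lightning_flash_def intro: contractible_if_flash)
qed

end

section \<open>Maps from a triangle to its rotation\<close>

text \<open>The first square of \<open>(u, v, h)\<close> commutes trivially. In the others one side
  is a composite of consecutive maps of the triangle, hence zero, which leaves these two equations
  on \<open>h\<close>.\<close>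

locale triangle_rotation_map = exact_triangle +
  fixes h
  assumes h_Hom: "h \<in> Hom T Z (Susp T X)"
    and h_comp_v: "h \<cdot> v = Zero T Y (Susp T X)"
    and susp_u_comp_h: "susp T u \<cdot> h = Zero T Z (Susp T Y)"
begin

abbreviation "source \<equiv> (u, v, w)"
abbreviation "target \<equiv> (v, w, \<ominus> susp T u)"

lemmas h_simps [simp] = h_Hom[unfolded Hom_iff] h_comp_v susp_u_comp_h
  h_comp_v[THEN comp_eq_comp] susp_u_comp_h[THEN comp_eq_comp]

lemma h_factors:
  obtains \<phi> where "\<phi> \<in> Hom T (Susp T X) (Susp T X)" "h = \<phi> \<cdot> w"
  using cokernel_v[OF h_Hom] by auto

section \<open>Lightning flashes and the Toda bracket\<close>

lemma flash_iff: "lightning_flash T source h \<longleftrightarrow> (\<exists>\<theta> \<in> Hom T (Susp T X) Z. h = w \<cdot> \<theta> \<cdot> w)"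
  by (simp add: lightning_flash_def)

lemma Toda_bracket_iff_flash:
  "Zero T (Susp T Y) (Susp T Y) \<in> Toda_bracket T (\<ominus> susp T u) h v \<longleftrightarrow> lightning_flash T source h"
proof
  assume "Zero T (Susp T Y) (Susp T Y) \<in> Toda_bracket T (\<ominus> susp T u) h v"
  then obtain p q \<phi> where pq: "(v, p, q) \<in> Exact T" and \<phi>: "\<phi> \<in> Hom T (Cod T p) (Susp T X)"
      "\<phi> \<cdot> p = h" "(\<ominus> susp T u) \<cdot> \<phi> = Zero T (Susp T Y) (Susp T Y) \<cdot> q"
    unfolding Toda_bracket_def by auto
  obtain C where C: "p \<in> Hom T Z C" "q \<in> Hom T C (Susp T Y)"
    using exact_Hom[OF pq] v_Hom by (metis Hom_iff)
  note [simp] = C[unfolded Hom_iff]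
  have [simp]: "C \<in> Ob T" "\<phi> \<in> Arr T" "Dom T \<phi> = C" "Cod T \<phi> = Susp T X"
    using \<phi>(1) arr_facts[of q] by (simp_all add: Hom_iff)
  have "\<phi> \<in> Hom T C (Susp T X)" "susp T u \<cdot> \<phi> = Zero T C (Susp T Y)"
    using \<phi>(3) by (simp_all add: Hom_iff)
  then obtain \<theta> where \<theta>: "\<theta> \<in> Hom T C Z" "\<phi> = w \<cdot> \<theta>" by (rule kernel_susp_u)
  \<comment> \<open>The bracket allows any cone \<open>C\<close> of \<open>v\<close>;
    \<open>s\<close> compares the cone \<open>Susp T X\<close> with it and carries \<theta> back to
    the given triangle.\<close>
  obtain s where s: "s \<in> Hom T (Susp T X) C" "s \<cdot> w = p"
    using exact_fill[OF exact_rotate[OF exact] pq, of "Ident T Y" "Ident T Z"]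
    by (auto simp: Hom_iff)
  note [simp] = \<theta>(1)[unfolded Hom_iff] s(1)[unfolded Hom_iff]
  have "h = w \<cdot> (\<theta> \<cdot> s) \<cdot> w"
    by (simp add: \<theta>(2) s(2) flip: \<phi>(2))
  then show "lightning_flash T source h"
    unfolding flash_iff by (intro bexI[of _ "\<theta> \<cdot> s"]) (simp_all add: Hom_iff)
next
  assume "lightning_flash T source h"
  then obtain \<theta> where \<theta>: "\<theta> \<in> Hom T (Susp T X) Z" "h = w \<cdot> \<theta> \<cdot> w" unfolding flash_iff by blast
  note [simp] = \<theta>(1)[unfolded Hom_iff]
  show "Zero T (Susp T Y) (Susp T Y) \<in> Toda_bracket T (\<ominus> susp T u) h v"
    unfolding Toda_bracket_def
  proof (intro CollectI conjI exI bexI)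
    show "(v, w, \<ominus> susp T u) \<in> Exact T" using exact_rotate[OF exact] .
    show "w \<cdot> \<theta> \<in> Hom T (Cod T w) (Cod T h)" "(w \<cdot> \<theta>) \<cdot> w = h"
      "(\<ominus> susp T u) \<cdot> (w \<cdot> \<theta>) = Zero T (Susp T Y) (Susp T Y) \<cdot> \<ominus> susp T u"
      "Zero T (Susp T Y) (Susp T Y) \<in> Hom T (Susp T (Dom T v)) (Cod T (\<ominus> susp T u))"
      using \<theta>(2) by (simp_all add: Hom_iff)
  qed
qed

section \<open>Verdier goodness\<close>

text \<open>Write \<alpha> as \<open>vA \<oplus> \<delta> \<cdot> w\<close> with \<delta> a section
  of \<open>wA\<close>. Then \<open>h\<close> is
  \<open>(1 + \<beta> \<cdot> \<delta>) \<cdot> w\<close>, and the relation between \<beta> and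
  \<open>wA\<close> shows that \<open>susp T u\<close> kills the bracket, so the bracket lifts along
  \<open>w\<close>.\<close>

lemma flash_of_octahedra:
  assumes vA: "(v \<cdot> u, vA, wA) \<in> Exact T"
    and \<alpha>: "\<alpha> \<in> Hom T Z (Cod T vA)" "\<alpha> \<cdot> v = vA \<cdot> v" "wA \<cdot> \<alpha> = w"
    and \<beta>: "\<beta> \<in> Hom T (Cod T vA) (Susp T X)" "\<beta> \<cdot> vA = w" "(\<ominus> susp T u) \<cdot> \<beta> = susp T u \<cdot> wA"
    and h: "h = \<beta> \<cdot> \<alpha>"
  shows "lightning_flash T source h"
proof -
  obtain A where A: "vA \<in> Hom T Z A" "wA \<in> Hom T A (Susp T X)"
    using exact_Hom[OF vA] uvw comp_eq_zero(1) obs zero_facts by (metis Hom_iff)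
  note [simp] = A[unfolded Hom_iff]
  have [simp]: "A \<in> Ob T" using arr_facts[of wA] by simp
  have [simp]: "\<alpha> \<in> Arr T" "Dom T \<alpha> = Z" "Cod T \<alpha> = A" "\<beta> \<in> Arr T" "Dom T \<beta> = A" "Cod T \<beta> = Susp T X"
    using \<alpha>(1) \<beta>(1) by (simp_all add: Hom_iff)
  have wAvA: "wA \<cdot> vA = Zero T Z (Susp T X)"
    using exact_comp_zero[OF exact_rotate[OF vA]] by simp
  \<comment> \<open>As \<open>v \<cdot> u\<close> is zero, its suspension kills the identity of
    \<open>Susp T X\<close>, which therefore lifts along \<open>wA\<close>.\<close>
  obtain s where s: "s \<in> Hom T (Susp T X) A" "Ident T (Susp T X) = wA \<cdot> s"
    using weak_kernel[OF exact_rotate[OF exact_rotate[OF vA]], of "Ident T (Susp T X)" "Susp T X"]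
    by (auto simp: Hom_iff)
  note [simp] = s(1)[unfolded Hom_iff]
  have "\<alpha> \<oplus> \<ominus> vA \<in> Hom T Z A" "(\<alpha> \<oplus> \<ominus> vA) \<cdot> v = Zero T Y A"
    using \<alpha>(2) by (simp_all add: Hom_iff)
  then obtain \<delta>' where \<delta>': "\<delta>' \<in> Hom T (Susp T X) A" "\<alpha> \<oplus> \<ominus> vA = \<delta>' \<cdot> w" by (rule cokernel_v)
  note [simp] = \<delta>'(1)[unfolded Hom_iff]
  have w\<delta>'w: "wA \<cdot> \<delta>' \<cdot> w = w"
    using arg_cong[OF \<delta>'(2), of "\<lambda>x. wA \<cdot> x"] by (simp add: \<alpha>(3) wAvA)
  \<comment> \<open>The correction makes \<delta> a section of \<open>wA\<close>. It does not change
    the composite with \<open>w\<close>, because \<open>wA \<cdot> \<delta>'\<close> fixes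
    \<open>w\<close>.\<close>
  define \<delta> where "\<delta> = \<delta>' \<oplus> s \<cdot> (Ident T (Susp T X) \<oplus> \<ominus> (wA \<cdot> \<delta>'))"
  have \<delta>: "\<delta> \<in> Hom T (Susp T X) A" by (simp add: \<delta>_def Hom_iff)
  note [simp] = \<delta>[unfolded Hom_iff]
  have wA\<delta>: "wA \<cdot> \<delta> = Ident T (Susp T X)"
    using comp_eq_comp[OF s(2)[symmetric]]
      add_left_commute[of "wA \<cdot> \<delta>'" "Ident T (Susp T X)" "\<ominus> (wA \<cdot> \<delta>')"]
    by (simp add: \<delta>_def flip: s(2))
  have "\<alpha> = vA \<oplus> \<delta>' \<cdot> w"
    using \<delta>'(2) eq_add_iff[of \<alpha> Z A vA "\<delta>' \<cdot> w"] by (simp add: Hom_iff)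
  moreover have "\<delta> \<cdot> w = \<delta>' \<cdot> w" by (simp add: \<delta>_def w\<delta>'w)
  ultimately have h': "h = w \<oplus> \<beta> \<cdot> \<delta> \<cdot> w" unfolding h by (simp add: \<beta>(2))
  have "susp T u \<cdot> \<beta> = \<ominus> (susp T u \<cdot> wA)" using \<beta>(3) by (simp flip: \<beta>(3))
  then have "susp T u \<cdot> \<beta> \<cdot> \<delta> = (\<ominus> (susp T u \<cdot> wA)) \<cdot> \<delta>"
    by (rule comp_eq_comp) simp_all
  then have "Ident T (Susp T X) \<oplus> \<beta> \<cdot> \<delta> \<in> Hom T (Susp T X) (Susp T X)"
    and "susp T u \<cdot> (Ident T (Susp T X) \<oplus> \<beta> \<cdot> \<delta>) = Zero T (Susp T X) (Susp T Y)"
    by (simp_all add: wA\<delta> Hom_iff)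
  then obtain \<theta> where \<theta>: "\<theta> \<in> Hom T (Susp T X) Z" "Ident T (Susp T X) \<oplus> \<beta> \<cdot> \<delta> = w \<cdot> \<theta>"
    by (rule kernel_susp_u)
  note [simp] = \<theta>(1)[unfolded Hom_iff]
  have "h = (Ident T (Susp T X) \<oplus> \<beta> \<cdot> \<delta>) \<cdot> w" unfolding h' by simp
  also have "\<dots> = w \<cdot> \<theta> \<cdot> w" unfolding \<theta>(2) by simp
  finally show ?thesis using \<theta>(1) unfolding flash_iff by blast
qed

lemma Verdier_good_if_flash:
  assumes "lightning_flash T source h"
  shows "Verdier_good T source target (u, v, h)"
proof -
  obtain \<theta> where \<theta>: "\<theta> \<in> Hom T (Susp T X) Z" "h = w \<cdot> \<theta> \<cdot> w"
    using assms unfolding flash_iff by blast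
  note [simp] = \<theta>(1)[unfolded Hom_iff]
  have "v \<cdot> u \<in> Arr T" by simp
  then obtain vA wA where vA: "(v \<cdot> u, vA, wA) \<in> Exact T" using Exact_exists by blast
  obtain A where A: "vA \<in> Hom T Z A" "wA \<in> Hom T A (Susp T X)"
    using exact_Hom[OF vA] uvw comp_eq_zero(1) obs zero_facts by (metis Hom_iff)
  note [simp] = A[unfolded Hom_iff]
  have [simp]: "A \<in> Ob T" using arr_facts[of wA] by simp
  have wAvA: "wA \<cdot> vA = Zero T Z (Susp T X)"
    using exact_comp_zero[OF exact_rotate[OF vA]] by simp
  note [simp] = wAvA comp_eq_comp[OF wAvA]
  \<comment> \<open>The target is the rotation of the source, so both required octahedra can use the
    same composite and the same three triangles.\<close>
  obtain \<alpha> \<beta> \<gamma> where oct: "octahedron T (u, v, w) (v, w, \<ominus> susp T u) (v \<cdot> u, vA, wA) (\<alpha>, \<beta>, \<gamma>)"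
    using octahedral_axiom[OF u_Hom v_Hom exact exact_rotate[OF exact] vA] by blast
  then have \<alpha>\<beta>\<gamma>: "\<alpha> \<in> Hom T Z A" "\<beta> \<in> Hom T A (Susp T X)" "\<gamma> \<in> Hom T (Susp T X) (Susp T Z)"
      "(\<alpha>, \<beta>, \<gamma>) \<in> Exact T" "\<alpha> \<cdot> v = vA \<cdot> v" "wA \<cdot> \<alpha> = w" "\<beta> \<cdot> vA = w"
      "\<gamma> = susp T v \<cdot> \<ominus> susp T u" "(\<ominus> susp T u) \<cdot> \<beta> = susp T u \<cdot> wA"
    unfolding octahedron_def by (auto simp: Hom_iff)
  note [simp] = \<alpha>\<beta>\<gamma>(1-3)[unfolded Hom_iff]
  have \<beta>\<alpha>: "\<beta> \<cdot> \<alpha> = Zero T Z (Susp T X)"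
    using exact_comp_zero[OF \<alpha>\<beta>\<gamma>(4)] by simp
  have u\<beta>: "susp T u \<cdot> \<beta> = \<ominus> (susp T u \<cdot> wA)" using \<alpha>\<beta>\<gamma>(9) by (simp flip: \<alpha>\<beta>\<gamma>(9))
  text \<open>Twisting one of two equal octahedra by the automorphism \<open>\<tau>\<close> of the cone of \<open>v u = 0\<close>
    changes \<open>\<beta> \<alpha> = 0\<close> to \<open>w \<theta> w\<close>.\<close>
  define \<tau> where "\<tau> = Ident T A \<oplus> vA \<cdot> \<theta> \<cdot> wA"
  define \<sigma> where "\<sigma> = Ident T A \<oplus> \<ominus> (vA \<cdot> \<theta> \<cdot> wA)"
  have \<tau>: "\<tau> \<in> Hom T A A" and \<sigma>: "\<sigma> \<in> Hom T A A" by (simp_all add: \<tau>_def \<sigma>_def Hom_iff)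
  note [simp] = \<tau>[unfolded Hom_iff] \<sigma>[unfolded Hom_iff]
  \<comment> \<open>The added term has square zero because \<open>wA \<cdot> vA\<close> is
    zero.\<close>
  have \<sigma>\<tau>: "\<sigma> \<cdot> \<tau> = Ident T A" and \<tau>\<sigma>: "\<tau> \<cdot> \<sigma> = Ident T A"
    by (simp_all add: \<tau>_def \<sigma>_def add_ac)
  have "(\<tau> \<cdot> \<alpha>, \<beta> \<cdot> \<sigma>, \<gamma>) \<in> Exact T"
  proof (rule Exact_iso[OF \<alpha>\<beta>\<gamma>(4)])
    show "candidate_triangle T (\<tau> \<cdot> \<alpha>, \<beta> \<cdot> \<sigma>, \<gamma>)"
      by (simp add: candidate_triangle_def Hom_iff)
    show "triangle_map T (\<alpha>, \<beta>, \<gamma>) (\<tau> \<cdot> \<alpha>, \<beta> \<cdot> \<sigma>, \<gamma>) (Ident T Z, \<tau>, Ident T (Susp T X))"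
      by (simp add: triangle_map_def Hom_iff \<sigma>\<tau>)
    show "iso_arr T \<tau>" by (rule iso_arrI[OF \<tau> \<sigma> \<sigma>\<tau> \<tau>\<sigma>])
  qed (simp_all add: iso_arr_Ident)
  moreover have "(\<tau> \<cdot> \<alpha>) \<cdot> v = vA \<cdot> v" "wA \<cdot> \<tau> \<cdot> \<alpha> = w" "(\<beta> \<cdot> \<sigma>) \<cdot> vA = w"
    by (simp_all add: \<tau>_def \<sigma>_def \<alpha>\<beta>\<gamma>(5-7) comp_eq_comp[OF \<alpha>\<beta>\<gamma>(6)])
  moreover have "(\<ominus> susp T u) \<cdot> \<beta> \<cdot> \<sigma> = susp T u \<cdot> wA"
    by (simp add: \<sigma>_def comp_eq_comp[OF u\<beta>] u\<beta>)
  ultimately have "octahedron T (u, v, w) (v, w, \<ominus> susp T u) (v \<cdot> u, vA, wA) (\<tau> \<cdot> \<alpha>, \<beta> \<cdot> \<sigma>, \<gamma>)"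
    using \<alpha>\<beta>\<gamma>(8) unfolding octahedron_def by (simp add: Hom_iff)
  moreover have "h = \<beta> \<cdot> \<tau> \<cdot> \<alpha>"
    by (simp add: \<tau>_def \<theta>(2) \<beta>\<alpha> \<alpha>\<beta>\<gamma>(6) comp_eq_comp[OF \<alpha>\<beta>\<gamma>(7)])
  \<comment> \<open>The twisted octahedron supplies \<alpha>\<open>\<^sub>1\<close>, the original
    one \<beta>\<open>\<^sub>2\<close>.\<close>
  ultimately show ?thesis
    unfolding Verdier_good_def prod.case using exact exact_rotate[OF exact] vA oct by blast
qed

lemma Verdier_good_iff_flash:
  "Verdier_good T source target (u, v, h) \<longleftrightarrow> lightning_flash T source h"
proof
  assume "Verdier_good T source target (u, v, h)"
  then obtain f' f'' g' g'' vA wA \<alpha>\<^sub>1 \<beta>\<^sub>1 \<gamma>\<^sub>1 \<alpha>\<^sub>2 \<beta>\<^sub>2 \<gamma>\<^sub>2 where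
    "(v \<cdot> u, vA, wA) \<in> Exact T"
    "octahedron T (u, v, w) (v, g', g'') (v \<cdot> u, vA, wA) (\<alpha>\<^sub>1, \<beta>\<^sub>1, \<gamma>\<^sub>1)"
    "octahedron T (u, f', f'') (v, w, \<ominus> susp T u) (v \<cdot> u, vA, wA) (\<alpha>\<^sub>2, \<beta>\<^sub>2, \<gamma>\<^sub>2)"
    "h = \<beta>\<^sub>2 \<cdot> \<alpha>\<^sub>1"
    unfolding Verdier_good_def prod.case by blast
  then show "lightning_flash T source h"
    by (intro flash_of_octahedra[of vA wA \<alpha>\<^sub>1 \<beta>\<^sub>2]) (simp_all add: octahedron_def)
qed (rule Verdier_good_if_flash)

section \<open>Mapping cones and goodness\<close>

text \<open>The three matrices are upper triangular with rows \<open>(v, v)\<close>,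
  \<open>(0, -v)\<close>, then \<open>(w, h)\<close>, \<open>(0, -w)\<close>, then
  \<open>(-\<Sigma>u, \<Sigma>u)\<close>, \<open>(0, -\<Sigma>u)\<close>. Their rows and columns
  replace the definition of the cone from here on.\<close>

lemma mapping_cone_cases:
  obtains P Q R i1 i2 p1 p2 j1 j2 q1 q2 k1 k2 r1 r2 m n l where
    "mapping_cone T source target (u, v, h) = (m, n, l)"
    "biproduct T Y Y P i1 i2 p1 p2" "biproduct T Z Z Q j1 j2 q1 q2"
    "biproduct T (Susp T X) (Susp T X) R k1 k2 r1 r2"
    "m \<in> Hom T P Q" "n \<in> Hom T Q R" "l \<in> Hom T R (Susp T P)"
    "m \<cdot> i1 = j1 \<cdot> v" "m \<cdot> i2 = j1 \<cdot> v \<oplus> \<ominus> (j2 \<cdot> v)"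
    "q1 \<cdot> m = v \<cdot> p1 \<oplus> v \<cdot> p2" "q2 \<cdot> m = \<ominus> (v \<cdot> p2)"
    "n \<cdot> j1 = k1 \<cdot> w" "n \<cdot> j2 = k1 \<cdot> h \<oplus> \<ominus> (k2 \<cdot> w)"
    "r1 \<cdot> n = w \<cdot> q1 \<oplus> h \<cdot> q2" "r2 \<cdot> n = \<ominus> (w \<cdot> q2)"
    "l \<cdot> k1 = \<ominus> (susp T i1 \<cdot> susp T u)"
    "l \<cdot> k2 = susp T i1 \<cdot> susp T u \<oplus> \<ominus> (susp T i2 \<cdot> susp T u)"
    "susp T p1 \<cdot> l = \<ominus> (susp T u \<cdot> r1) \<oplus> susp T u \<cdot> r2" "susp T p2 \<cdot> l = \<ominus> (susp T u \<cdot> r2)"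
proof -
  obtain P i1 i2 p1 p2 where B1: "biprod T Y Y = (i1, i2, p1, p2)" "biproduct T Y Y P i1 i2 p1 p2"
    using biprod_biproduct[OF obs(2) obs(2)] .
  obtain Q j1 j2 q1 q2 where B2: "biprod T Z Z = (j1, j2, q1, q2)" "biproduct T Z Z Q j1 j2 q1 q2"
    using biprod_biproduct[OF obs(3) obs(3)] .
  obtain R k1 k2 r1 r2 where B3: "biprod T (Susp T X) (Susp T X) = (k1, k2, r1, r2)"
      "biproduct T (Susp T X) (Susp T X) R k1 k2 r1 r2"
    using biprod_biproduct[OF Susp_in_Ob[OF obs(1)] Susp_in_Ob[OF obs(1)]] .
  interpret B1: biproduct T Y Y P i1 i2 p1 p2 by fact
  interpret B2: biproduct T Z Z Q j1 j2 q1 q2 by fact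
  interpret B3: biproduct T "Susp T X" "Susp T X" R k1 k2 r1 r2 by fact
  define m where "m = matrix_map T (p1, p2) (j1, j2) ((v, v), (Zero T Y Z, \<ominus> v))"
  define n where "n = matrix_map T (q1, q2) (k1, k2) ((w, h), (Zero T Z (Susp T X), \<ominus> w))"
  define l where "l = matrix_map T (r1, r2) (susp T i1, susp T i2)
    ((\<ominus> susp T u, susp T u), (Zero T (Susp T X) (Susp T Y), \<ominus> susp T u))"
  note m = matrix_map_facts[OF B1(2) B2(2) _ _ _ _ m_def]
  note n = matrix_map_facts[OF B2(2) B3(2) _ _ _ _ n_def]
  note l = matrix_map_facts[OF B3(2) biproduct_susp[OF B1(2)] _ _ _ _ l_def]
  have "m \<in> Hom T P Q" "n \<in> Hom T Q R" "l \<in> Hom T R (Susp T P)"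
    by (rule m(1) n(1) l(1); simp add: Hom_iff)+
  note mnl = this[unfolded Hom_iff]
  show ?thesis
  proof (rule that[OF _ B1(2) B2(2) B3(2)])
    show "mapping_cone T source target (u, v, h) = (m, n, l)"
      by (simp add: mapping_cone_def Let_def B1(1) B2(1) B3(1) m_def n_def l_def)
  qed (simp_all add: m(2-) n(2-) l(2-) mnl Hom_iff)
qed

lemma flash_if_good:
  assumes "good T source target (u, v, h)"
  shows "lightning_flash T source h"
proof -
  obtain P Q R i1 i2 p1 p2 j1 j2 q1 q2 k1 k2 r1 r2 m n l where
      cone: "mapping_cone T source target (u, v, h) = (m, n, l)"
    and B: "biproduct T Y Y P i1 i2 p1 p2" "biproduct T Z Z Q j1 j2 q1 q2"
      "biproduct T (Susp T X) (Susp T X) R k1 k2 r1 r2"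
    and mnl: "m \<in> Hom T P Q" "n \<in> Hom T Q R" "l \<in> Hom T R (Susp T P)"
    and m: "q1 \<cdot> m = v \<cdot> p1 \<oplus> v \<cdot> p2"
    and n: "n \<cdot> j1 = k1 \<cdot> w" "n \<cdot> j2 = k1 \<cdot> h \<oplus> \<ominus> (k2 \<cdot> w)"
    and l: "l \<cdot> k1 = \<ominus> (susp T i1 \<cdot> susp T u)"
      "l \<cdot> k2 = susp T i1 \<cdot> susp T u \<oplus> \<ominus> (susp T i2 \<cdot> susp T u)"
    by (rule mapping_cone_cases) blast
  interpret B1: biproduct T Y Y P i1 i2 p1 p2 by fact
  interpret B2: biproduct T Z Z Q j1 j2 q1 q2 by fact
  interpret B3: biproduct T "Susp T X" "Susp T X" R k1 k2 r1 r2 by fact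
  interpret \<Sigma>B1: biproduct T "Susp T Y" "Susp T Y" "Susp T P" "susp T i1" "susp T i2" "susp T p1" "susp T p2"
    by (rule biproduct_susp) fact
  note [simp] = mnl[unfolded Hom_iff]
  have "(m, n, l) \<in> Exact T" using assms by (simp add: good_def cone)
  \<comment> \<open>The first row of \<open>m\<close> is \<open>(v, v)\<close>, so
    \<open>p1 \<oplus> p2\<close> and \<open>q1\<close> form a commuting square from
    \<open>m\<close> to \<open>v\<close>.\<close>
  then obtain t where t: "t \<in> Hom T R (Susp T X)" "t \<cdot> n = w \<cdot> q1"
      "(\<ominus> susp T u) \<cdot> t = susp T (p1 \<oplus> p2) \<cdot> l"
    by (rule exact_fill[OF _ exact_rotate[OF exact], of m n l "p1 \<oplus> p2" q1])
      (auto simp: Hom_iff m)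
  note [simp] = t(1)[unfolded Hom_iff]
  have ut: "susp T u \<cdot> t = \<ominus> (susp T (p1 \<oplus> p2) \<cdot> l)" using arg_cong[OF t(3), of "neg T"] by simp
  have tk1w: "t \<cdot> k1 \<cdot> w = w"
    using arg_cong[OF n(1), of "\<lambda>x. t \<cdot> x"] by (simp add: comp_eq_comp[OF t(2)])
  have tk2w: "t \<cdot> k1 \<cdot> h = t \<cdot> k2 \<cdot> w"
    using arg_cong[OF n(2), of "\<lambda>x. t \<cdot> x"] add_neg_eq_zero_iff[of "t \<cdot> k1 \<cdot> h" Z "Susp T X" "t \<cdot> k2 \<cdot> w"]
    by (simp add: comp_eq_comp[OF t(2)] Hom_iff)
  \<comment> \<open>By the last square, composing with \<open>susp T u\<close> turns the first
    column of \<open>t\<close> into \<open>susp T u\<close> and the second into zero.\<close>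
  have "t \<cdot> k1 \<oplus> \<ominus> Ident T (Susp T X) \<in> Hom T (Susp T X) (Susp T X)"
    and "susp T u \<cdot> (t \<cdot> k1 \<oplus> \<ominus> Ident T (Susp T X)) = Zero T (Susp T X) (Susp T Y)"
    by (simp_all add: Hom_iff comp_eq_comp[OF ut] l)
  then obtain \<alpha> where \<alpha>: "\<alpha> \<in> Hom T (Susp T X) Z" "t \<cdot> k1 \<oplus> \<ominus> Ident T (Susp T X) = w \<cdot> \<alpha>"
    by (rule kernel_susp_u)
  have "t \<cdot> k2 \<in> Hom T (Susp T X) (Susp T X)"
    and "susp T u \<cdot> (t \<cdot> k2) = Zero T (Susp T X) (Susp T Y)"
    by (simp_all add: Hom_iff comp_eq_comp[OF ut] l)
  then obtain \<beta> where \<beta>: "\<beta> \<in> Hom T (Susp T X) Z" "t \<cdot> k2 = w \<cdot> \<beta>" by (rule kernel_susp_u)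
  \<comment> \<open>Writing \<open>h\<close> through \<open>w\<close> gives the term
    \<open>w \<cdot> \<alpha> \<cdot> h\<close> the shape of a flash too.\<close>
  obtain \<phi> where \<phi>: "\<phi> \<in> Hom T (Susp T X) (Susp T X)" "h = \<phi> \<cdot> w" by (rule h_factors)
  note [simp] = \<alpha>(1)[unfolded Hom_iff] \<beta>(1)[unfolded Hom_iff] \<phi>(1)[unfolded Hom_iff]
  have "t \<cdot> k1 \<cdot> h \<oplus> \<ominus> h = w \<cdot> \<alpha> \<cdot> h"
    using arg_cong[OF \<alpha>(2), of "\<lambda>x. x \<cdot> h"] by simp
  then have "t \<cdot> k1 \<cdot> h = h \<oplus> w \<cdot> \<alpha> \<cdot> h"
    using eq_add_iff[of "t \<cdot> k1 \<cdot> h" Z "Susp T X" h "w \<cdot> \<alpha> \<cdot> h"] by (simp add: Hom_iff)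
  moreover have "t \<cdot> k1 \<cdot> h = w \<cdot> \<beta> \<cdot> w"
    unfolding tk2w using \<beta>(2) comp_eq_comp[OF \<beta>(2), of w] comp_assoc[of w k2 t] by simp
  ultimately have "w \<cdot> \<beta> \<cdot> w = w \<cdot> \<alpha> \<cdot> h \<oplus> h"
    using add_commute[of h "w \<cdot> \<alpha> \<cdot> h"] by simp
  then have "h = w \<cdot> \<beta> \<cdot> w \<oplus> \<ominus> (w \<cdot> \<alpha> \<cdot> h)"
    using eq_add_iff[of "w \<cdot> \<beta> \<cdot> w" Z "Susp T X" "w \<cdot> \<alpha> \<cdot> h" h] by (simp add: Hom_iff)
  also have "\<dots> = w \<cdot> (\<beta> \<oplus> \<ominus> (\<alpha> \<cdot> \<phi>)) \<cdot> w"
    unfolding \<phi>(2) by simp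
  finally show ?thesis
    unfolding flash_iff by (intro bexI[of _ "\<beta> \<oplus> \<ominus> (\<alpha> \<cdot> \<phi>)"]) (simp_all add: Hom_iff)
qed

text \<open>By \<open>exact_of_weakly_exact\<close> it is enough to lift along the maps of the cone,
  by back substitution, and to compare the cone with an exact triangle on \<open>m\<close>.\<close>

lemma good_if_flash:
  assumes "lightning_flash T source h"
  shows "good T source target (u, v, h)"
proof -
  obtain \<theta> where \<theta>: "\<theta> \<in> Hom T (Susp T X) Z" "h = w \<cdot> \<theta> \<cdot> w"
    using assms unfolding flash_iff by blast
  obtain P Q R i1 i2 p1 p2 j1 j2 q1 q2 k1 k2 r1 r2 m n l where
      cone: "mapping_cone T source target (u, v, h) = (m, n, l)"
    and B: "biproduct T Y Y P i1 i2 p1 p2" "biproduct T Z Z Q j1 j2 q1 q2"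
      "biproduct T (Susp T X) (Susp T X) R k1 k2 r1 r2"
    and mnl: "m \<in> Hom T P Q" "n \<in> Hom T Q R" "l \<in> Hom T R (Susp T P)"
    and m: "m \<cdot> i1 = j1 \<cdot> v" "m \<cdot> i2 = j1 \<cdot> v \<oplus> \<ominus> (j2 \<cdot> v)"
      "q1 \<cdot> m = v \<cdot> p1 \<oplus> v \<cdot> p2" "q2 \<cdot> m = \<ominus> (v \<cdot> p2)"
    and n: "n \<cdot> j1 = k1 \<cdot> w" "n \<cdot> j2 = k1 \<cdot> h \<oplus> \<ominus> (k2 \<cdot> w)"
      "r1 \<cdot> n = w \<cdot> q1 \<oplus> h \<cdot> q2" "r2 \<cdot> n = \<ominus> (w \<cdot> q2)"
    and l: "l \<cdot> k1 = \<ominus> (susp T i1 \<cdot> susp T u)"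
      "l \<cdot> k2 = susp T i1 \<cdot> susp T u \<oplus> \<ominus> (susp T i2 \<cdot> susp T u)"
      "susp T p1 \<cdot> l = \<ominus> (susp T u \<cdot> r1) \<oplus> susp T u \<cdot> r2" "susp T p2 \<cdot> l = \<ominus> (susp T u \<cdot> r2)"
    by (rule mapping_cone_cases) blast
  interpret B1: biproduct T Y Y P i1 i2 p1 p2 by fact
  interpret B2: biproduct T Z Z Q j1 j2 q1 q2 by fact
  interpret B3: biproduct T "Susp T X" "Susp T X" R k1 k2 r1 r2 by fact
  interpret \<Sigma>B1: biproduct T "Susp T Y" "Susp T Y" "Susp T P" "susp T i1" "susp T i2" "susp T p1" "susp T p2"
    by (rule biproduct_susp) fact
  interpret \<Sigma>B2: biproduct T "Susp T Z" "Susp T Z" "Susp T Q" "susp T j1" "susp T j2" "susp T q1" "susp T q2"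
    by (rule biproduct_susp) fact
  note [simp] = mnl[unfolded Hom_iff] \<theta>(1)[unfolded Hom_iff]
  obtain p q where pq: "(m, p, q) \<in> Exact T" using Exact_exists[of m] by auto
  obtain C where C: "p \<in> Hom T Q C" "q \<in> Hom T C (Susp T P)"
    using exact_Hom[OF pq] mnl by (metis Hom_iff)
  note [simp] = C[unfolded Hom_iff]
  have [simp]: "C \<in> Ob T" using arr_facts[of q] by simp
  obtain s1 where s1: "s1 \<in> Hom T (Susp T X) C" "s1 \<cdot> w = p \<cdot> j1"
      "q \<cdot> s1 = susp T i1 \<cdot> \<ominus> susp T u"
    using exact_fill[OF exact_rotate[OF exact] pq, of i1 j1] by (auto simp: Hom_iff m)
  \<comment> \<open>This column operation diagonalises \<open>m\<close>: both
    \<open>j1 \<cdot> v\<close> and \<open>j2 \<cdot> v\<close> factor through it, which yields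
    \<open>s1\<close> and \<open>s2\<close>.\<close>
  have "m \<cdot> (i1 \<oplus> \<ominus> i2) = j2 \<cdot> v" by (simp add: m)
  then obtain s2 where s2: "s2 \<in> Hom T (Susp T X) C" "s2 \<cdot> w = p \<cdot> j2"
      "q \<cdot> s2 = susp T (i1 \<oplus> \<ominus> i2) \<cdot> \<ominus> susp T u"
    using exact_fill[OF exact_rotate[OF exact] pq, of "i1 \<oplus> \<ominus> i2" j2] by (auto simp: Hom_iff)
  note [simp] = s1(1)[unfolded Hom_iff] s2(1)[unfolded Hom_iff]
  \<comment> \<open>Composed with \<open>w\<close>, the second column must be
    \<open>s1 \<cdot> h \<oplus> \<ominus> (s2 \<cdot> w)\<close>. Since \<open>h\<close> is
    \<open>w \<cdot> \<theta> \<cdot> w\<close>, a final \<open>w\<close> splits off and leaves this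
    column.\<close>
  define \<phi> where "\<phi> = s1 \<cdot> r1 \<oplus> (s1 \<cdot> w \<cdot> \<theta> \<oplus> \<ominus> s2) \<cdot> r2"
  have \<phi>: "\<phi> \<in> Hom T R C" by (simp add: \<phi>_def Hom_iff)
  note [simp] = \<phi>[unfolded Hom_iff]
  have "(m, n, l) \<in> Exact T"
  proof (rule exact_of_weakly_exact[OF pq mnl])
    show "n \<cdot> m = Zero T P R"
      by (rule B1.eq_from_biproduct) (simp_all add: Hom_iff m n comp_eq_comp[OF n(1)] comp_eq_comp[OF n(2)])
    show "\<exists>y \<in> Hom T W Q. x = n \<cdot> y"
      if x: "x \<in> Hom T W R" "l \<cdot> x = Zero T W (Susp T P)" for W x
    proof -
      have [simp]: "W \<in> Ob T" using x(1) by (auto simp: Hom_iff)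
      note [simp] = x(1)[unfolded Hom_iff]
      have 2: "susp T u \<cdot> r2 \<cdot> x = Zero T W (Susp T Y)"
        using arg_cong[OF x(2), of "\<lambda>x. susp T p2 \<cdot> x"] by (simp add: comp_eq_comp[OF l(4)])
      obtain b2 where b2: "b2 \<in> Hom T W Z" "r2 \<cdot> x = w \<cdot> b2"
        by (rule kernel_susp_u[OF _ 2]) (simp add: Hom_iff)
      note [simp] = b2(1)[unfolded Hom_iff]
      \<comment> \<open>The summand \<open>h \<cdot> b2\<close> compensates the upper right entry of
        \<open>n\<close>, and \<open>susp T u\<close> kills it.\<close>
      have "susp T u \<cdot> (r1 \<cdot> x \<oplus> h \<cdot> b2) = Zero T W (Susp T Y)"
        using arg_cong[OF x(2), of "\<lambda>x. susp T p1 \<cdot> x"] by (simp add: comp_eq_comp[OF l(3)] 2)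
      then obtain b1 where b1: "b1 \<in> Hom T W Z" "r1 \<cdot> x \<oplus> h \<cdot> b2 = w \<cdot> b1"
        by (rule kernel_susp_u[rotated]) (simp_all add: Hom_iff)
      note [simp] = b1(1)[unfolded Hom_iff]
      have "x = n \<cdot> (j1 \<cdot> b1 \<oplus> \<ominus> (j2 \<cdot> b2))"
        by (rule B3.eq_to_biproduct)
          (simp_all add: Hom_iff comp_eq_comp[OF n(3)] comp_eq_comp[OF n(4)] b2(2) add_assoc flip: b1(2))
      then show ?thesis by (intro bexI[of _ "j1 \<cdot> b1 \<oplus> \<ominus> (j2 \<cdot> b2)"]) (simp_all add: Hom_iff)
    qed
    show "\<exists>y \<in> Hom T W R. x = l \<cdot> y"
      if x: "x \<in> Hom T W (Susp T P)" "susp T m \<cdot> x = Zero T W (Susp T Q)" for W x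
    proof -
      have [simp]: "W \<in> Ob T" using x(1) by (auto simp: Hom_iff)
      note [simp] = x(1)[unfolded Hom_iff]
      have sm: "susp T q1 \<cdot> susp T m = susp T v \<cdot> susp T p1 \<oplus> susp T v \<cdot> susp T p2"
        "susp T q2 \<cdot> susp T m = \<ominus> (susp T v \<cdot> susp T p2)"
        using arg_cong[OF m(3), of "susp T"] arg_cong[OF m(4), of "susp T"] by simp_all
      have 2: "susp T v \<cdot> susp T p2 \<cdot> x = Zero T W (Susp T Z)"
        using arg_cong[OF x(2), of "\<lambda>x. susp T q2 \<cdot> x"] by (simp add: comp_eq_comp[OF sm(2)])
      have 1: "susp T v \<cdot> susp T p1 \<cdot> x = Zero T W (Susp T Z)"
        using arg_cong[OF x(2), of "\<lambda>x. susp T q1 \<cdot> x"] by (simp add: comp_eq_comp[OF sm(1)] 2)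
      obtain c1 where c1: "c1 \<in> Hom T W (Susp T X)" "susp T p1 \<cdot> x = susp T u \<cdot> c1"
        by (rule kernel_susp_v[OF _ 1]) (simp add: Hom_iff)
      obtain c2 where c2: "c2 \<in> Hom T W (Susp T X)" "susp T p2 \<cdot> x = susp T u \<cdot> c2"
        by (rule kernel_susp_v[OF _ 2]) (simp add: Hom_iff)
      note [simp] = c1(1)[unfolded Hom_iff] c2(1)[unfolded Hom_iff]
      \<comment> \<open>Solve the triangular system for \<open>l\<close>: the lower row gives
        \<open>\<ominus> c2\<close>, and substituting it above gives
        \<open>\<ominus> c1 \<oplus> \<ominus> c2\<close>.\<close>
      have "x = l \<cdot> (k1 \<cdot> (\<ominus> c1 \<oplus> \<ominus> c2) \<oplus> k2 \<cdot> \<ominus> c2)"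
        by (rule \<Sigma>B1.eq_to_biproduct)
          (simp_all add: Hom_iff comp_eq_comp[OF l(3)] comp_eq_comp[OF l(4)] c1(2) c2(2) add_assoc)
      then show ?thesis
        by (intro bexI[of _ "k1 \<cdot> (\<ominus> c1 \<oplus> \<ominus> c2) \<oplus> k2 \<cdot> \<ominus> c2"]) (simp_all add: Hom_iff)
    qed
    show "\<phi> \<in> Hom T R (Cod T p)" by (simp add: Hom_iff)
    show "\<phi> \<cdot> n = p"
      by (rule B2.eq_from_biproduct[of _ C])
        (simp_all add: Hom_iff n \<phi>_def s1(2) s2(2) \<theta>(2))
    show "q \<cdot> \<phi> = l"
      by (rule B3.eq_from_biproduct[of _ "Susp T P"])
        (simp_all add: Hom_iff l \<phi>_def comp_eq_comp[OF s1(3)] s1(3) s2(3))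
  qed
  then show ?thesis by (simp add: good_def cone)
qed

end

theorem proposition8p1:
  fixes T :: "('o, 'm, 'z) triangulated_category_scheme" (structure)
    and X Y Z :: 'o and u v w h :: 'm
  assumes "triangulated_category T"
    and "u \<in> Hom T X Y" and "v \<in> Hom T Y Z" and "w \<in> Hom T Z (Susp T X)"
    and "(u, v, w) \<in> Exact T"
    and "h \<in> Hom T Z (Susp T X)"
    and "triangle_map T (u, v, w) (v, w, \<ominus> susp T u) (u, v, h)"
  shows "(good T (u, v, w) (v, w, \<ominus> susp T u) (u, v, h)
            \<longleftrightarrow> Verdier_good T (u, v, w) (v, w, \<ominus> susp T u) (u, v, h)) \<and>
         (Verdier_good T (u, v, w) (v, w, \<ominus> susp T u) (u, v, h)
            \<longleftrightarrow> Zero T (Susp T Y) (Susp T Y) \<in> Toda_bracket T (\<ominus> susp T u) h v) \<and>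
         (Zero T (Susp T Y) (Susp T Y) \<in> Toda_bracket T (\<ominus> susp T u) h v
            \<longleftrightarrow> lightning_flash T (u, v, w) h) \<and>
         (h = w \<longrightarrow> (lightning_flash T (u, v, w) h \<longleftrightarrow> contractible T (u, v, w)))"
proof -
  interpret triangulated_category T by fact
  interpret exact_triangle T X Y Z u v w
    by unfold_locales fact+
  have h: "h \<in> Arr T" "Dom T h = Z" "Cod T h = Susp T X" using assms(6) by (simp_all add: Hom_iff)
  interpret triangle_rotation_map T X Y Z u v w h
  proof
    show "h \<in> Hom T Z (Susp T X)" by fact
    show "h \<cdot> v = Zero T Y (Susp T X)" "susp T u \<cdot> h = Zero T Z (Susp T Y)"
      using assms(7) h by (simp_all add: triangle_map_def eq_commute[of "Zero T Z (Susp T Y)"])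
  qed
  show ?thesis
    using good_if_flash flash_if_good Verdier_good_iff_flash Toda_bracket_iff_flash
      contractible_iff_flash by blast
qed

end
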